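(* Let $\mathcal R=(\mathcal F,\Pi,\mu,E,H,R)$ be an $E$-terminating EGTRS. If every conditional pair in $\mathsf{LCCP}(\mathcal R)\cup\mathsf{CVP}^{ps}(\mathcal R)\cup\mathsf{LCCP}(E,\mathcal R)\cup\mathsf{CVP}^{ps}(E)$ is joinable modulo $E$ w.r.t. $\to_{\mathcal R,E}$, then $\to_{\mathcal R}$ has the $\to_{\mathcal R,E}$-Church–Rosser property modulo $E$; consequently $\mathcal R$ is $E$-confluent.
   Context: Terms over a signature $\mathcal F$ and countable variables $\mathcal X$; $t|_p$, $t[s]_p$, root position $\Lambda$ standard. A replacement map $\mu$ assigns to each $k$-ary $f$ a set $\mu(f)\subseteq\{1,..,k\}$; active positions: $\mathcal{P}os^\mu(x)=\{\Lambda\}$, $\mathcal{P}os^\mu(f(t_1,..,t_k))=\{\Lambda\}\cup\{i.q\mid i\in\mu(f),q\in\mathcal{P}os^\mu(t_i)\}$; $\mathcal{P}os^\mu_{\mathcal F}(t)$ / $\mathcal{P}os^\mu_x(t)$ the active positions with a function symbol / the variable $x$; $\mathcal{V}ar^\mu(t)$ the variables with an active occurrence. An EGTRS is $\mathcal R=(\mathcal F,\Pi,\mu,E,H,R)$ with $\Pi$ a predicate signature containing binary $=,\to,\to^*$; $E$ conditional equations $s=t\Leftarrow c$; $H$ definite Horn clauses $A\Leftarrow c$ with head predicate not $=,\to,\to^*$; $R$ rules $\ell\to r\Leftarrow c$, $\ell\notin\mathcal X$; each $c$ a finite sequence of atoms; it is assumed that $=$ does not depend on $R$ (a predicate $P$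 depends on $R$ if $P\in\{\to,\to^*\}$ or some clause of $E\cup H$ with head predicate $P$ has a body atom whose predicate depends on $R$). $\overleftrightarrow E=\{s\to t\Leftarrow c,\ t\to s\Leftarrow c\mid s=t\Leftarrow c\in E\}$. $R^{rm}$: $R$ with $\approx$ replaced by new $\approx_{rm}$; $H^{rm}$: $H$ with $\approx,\to,\to^*$ replaced by new $\approx_{rm},\to_{rm},\to^*_{rm}$. $\mathsf{Th}^{CR}$: universal closures of (a) reflexivity, symmetry, transitivity of $=$, $x_i=y_i\Rightarrow f(..x_i..)=f(..y_i..)$ ($i\in\mu(f)$), $A_1\wedge..\wedge A_n\Rightarrow s=t$ for equations of $E$; (b) $x\to^*x$, $x\to y\wedge y\to^*z\Rightarrow x\to^*z$, $x_i\to y_i\Rightarrow f(..x_i..)\to f(..y_i..)$ ($i\in\mu(f)$), $A_1\wedge..\wedge A_n\Rightarrow\ell\to r$ for rules of $R^{rm}$; (c) $x\to^*_{ps}x$, $x\to_{ps}y\wedge y\to^*_{ps}z\Rightarrow x\to^*_{ps}z$, $\to_{ps}$-propagation for $i\in\mu(f)$, $x=\ell\wedge A_1\wedge..\wedge A_n\Rightarrow x\to_{ps}r$ ($x$ fresh) for rules of $R^{rm}$; (d) $x\to^*_{rm}x$, $x\to_{rm}y\wedge y\to^*_{rm}z\Rightarrow x\to^*_{rm}z$, $x=x'\wedge x'\to y'\wedge y'=y\Rightarrow x\to_{rm}y$; (e) the clauses of $H^{rm}$. $s\to_{\mathcal R}t$ / $s\to_{\mathcal R,E}t$ / $s\to_{\mathcal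 R/E}t$ iff $s\to t$ / $s\to_{ps}t$ / $s\to_{rm}t$ is deducible from $\mathsf{Th}^{CR}$; $s=_Et$ iff $s=t$ is deducible from (a) plus the clauses of $H$; $s\leftrightarrow_Et$ iff $s\to t$ is deducible from the theory of $x\to^*x$, $x\to y\wedge y\to^*z\Rightarrow x\to^*z$, $\to$-propagation for $i\in\mu(f)$, and $A_1\wedge..\wedge A_n\Rightarrow\lambda\to\rho$ for each $\lambda\to\rho\Leftarrow A_1,..,A_n\in\overleftrightarrow E$. $\mathcal R$ is $E$-terminating if there is no infinite $\to_{\mathcal R/E}$-sequence; $E$-confluent if whenever $t\to^*_{\mathcal R/E}t_1$ and $t\to^*_{\mathcal R/E}t_2$ there are $t_1',t_2'$ with $t_i\to^*_{\mathcal R/E}t_i'$ and $t_1'=_Et_2'$. $\to_{\mathcal R}$ has the $\to_{\mathcal R,E}$-Church–Rosser property modulo $E$ if for all terms $t,t'$ related by the reflexive–transitive closure of $\leftrightarrow_E\cup\to_{\mathcal R}\cup\leftarrow_{\mathcal R}$ there are $u,u'$ with $t\to^*_{\mathcal R,E}u$, $t'\to^*_{\mathcal R,E}u'$, $u=_Eu'$. A conditional pair $\langle s,t\rangle\Leftarrow A_1,..,A_n$ is joinable modulo $E$ w.r.t. $\to_{\mathcal R,E}$ if for every substitution $\sigma$ with each $\sigma(A_i)$ deducible from $\mathsf{Th}^{CR}$ there are $u,u'$ with $\sigma(s)\to^*_{\mathcal R,E}u$, $\sigma(t)\to^*_{\mathcal R,E}u'$, $u=_Eu'$. LCCP of variable-disjoint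 rules $\alpha:s\to t\Leftarrow c$, $\alpha':u\to v\Leftarrow d$ at $p\in\mathcal{P}os^\mu_{\mathcal F}(s)$: $\langle s[v]_p,t\rangle\Leftarrow s|_p=u,c,d$; $\mathsf{LCCP}(\mathcal R)$: LCCPs with $\alpha,\alpha'\in R^{rm}$; $\mathsf{LCCP}(E,\mathcal R)$: LCCPs with $\alpha\in\overleftrightarrow E$, $\alpha'\in R^{rm}$. For a rule $s\to t\Leftarrow c$, $x\in\mathcal{V}ar^\mu(s)$, $p\in\mathcal{P}os^\mu_x(s)$, fresh $x'$, the CVP is $\langle s[x']_p,t\rangle\Leftarrow x\to_{ps}x',c$; $\mathsf{CVP}^{ps}(\mathcal R)$ / $\mathsf{CVP}^{ps}(E)$: these for rules of $R^{rm}$ / of $\overleftrightarrow E$.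
   Formalization: In R^rm and H^rm the symbol ≈ is replaced by ≈_rm only when ≈ depends on R; otherwise it is kept. Taken literally the claim fails if ≈ is independent of R and occurs in E: E={b=c⇐a≈a}, H={x≈x}, R={a→b, a→c, c→d}. *)

theory Defs
  imports Main "HOL-Library.Countable" "HOL-Library.Infinite_Typeclass"
begin

datatype ('f, 'v) trm = Var 'v | Fun 'f "('f, 'v) trm list"

primrec tvars :: "('f, 'v) trm \<Rightarrow> 'v set" where
  "tvars (Var x) = {x}"
| "tvars (Fun f ts) = \<Union> (set (map tvars ts))"

primrec subst :: "('v \<Rightarrow> ('f, 'w) trm) \<Rightarrow> ('f, 'v) trm \<Rightarrow> ('f, 'w) trm" where
  "subst \<sigma> (Var x) = \<sigma> x"
| "subst \<sigma> (Fun f ts) = Fun f (map (subst \<sigma>) ts)"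

text \<open>Positions are lists of argument indices, the root position being the empty list.
  Arguments are counted from 0, so that a replacement map takes values in subsets of
  \<open>{..<k}\<close> instead of \<open>{1..k}\<close>.\<close>

fun subt_at :: "('f, 'v) trm \<Rightarrow> nat list \<Rightarrow> ('f, 'v) trm" where
  "subt_at t [] = t"
| "subt_at (Fun f ts) (i # p) = subt_at (ts ! i) p"

fun replace_at :: "('f, 'v) trm \<Rightarrow> nat list \<Rightarrow> ('f, 'v) trm \<Rightarrow> ('f, 'v) trm" where
  "replace_at t [] s = s"
| "replace_at (Fun f ts) (i # p) s = Fun f (ts[i := replace_at (ts ! i) p s])"

function active_pos :: "('f \<Rightarrow> nat set) \<Rightarrow> ('f, 'v) trm \<Rightarrow> nat list set" where
  "active_pos \<mu> (Var x) = {[]}"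
| "active_pos \<mu> (Fun f ts) =
     {[]} \<union> (\<Union>i \<in> \<mu> f \<inter> {..<length ts}. (#) i ` active_pos \<mu> (ts ! i))"
  by pat_completeness auto
termination
  by (relation "measure (\<lambda>(\<mu>, t). size t)")
    (auto simp: less_Suc_eq_le intro: size_list_estimation'[OF nth_mem])

definition active_fun_pos :: "('f \<Rightarrow> nat set) \<Rightarrow> ('f, 'v) trm \<Rightarrow> nat list set" where
  "active_fun_pos \<mu> t = {p \<in> active_pos \<mu> t. \<exists>f ts. subt_at t p = Fun f ts}"

definition active_var_pos :: "('f \<Rightarrow> nat set) \<Rightarrow> 'v \<Rightarrow> ('f, 'v) trm \<Rightarrow> nat list set" where
  "active_var_pos \<mu> x t = {p \<in> active_pos \<mu> t. subt_at t p = Var x}"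

definition active_vars :: "('f \<Rightarrow> nat set) \<Rightarrow> ('f, 'v) trm \<Rightarrow> 'v set" where
  "active_vars \<mu> t = {x. active_var_pos \<mu> x t \<noteq> {}}"

text \<open>The predicates \<open>=\<close>, \<open>\<rightarrow>\<close>, \<open>\<rightarrow>\<^sup>*\<close>, \<open>\<approx>\<close> and the user predicates \<open>Usr P\<close> may occur in a system;
  the remaining ones are the new predicates of the associated theory.\<close>

datatype 'p psym =
    Eq | Rew | Rews | Approx | Usr 'p
  | RewPs | RewsPs | RewRm | RewsRm | ApproxRm

datatype ('p, 'f, 'v) atom = Atom (apred: "'p psym") (aargs: "('f, 'v) trm list")

abbreviation bin :: "'p psym \<Rightarrow> ('f, 'v) trm \<Rightarrow> ('f, 'v) trm \<Rightarrow> ('p, 'f, 'v) atom" where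
  "bin P s t \<equiv> Atom P [s, t]"

definition asubst :: "('v \<Rightarrow> ('f, 'w) trm) \<Rightarrow> ('p, 'f, 'v) atom \<Rightarrow> ('p, 'f, 'w) atom" where
  "asubst \<sigma> A = Atom (apred A) (map (subst \<sigma>) (aargs A))"

definition avars :: "('p, 'f, 'v) atom \<Rightarrow> 'v set" where
  "avars A = \<Union> (tvars ` set (aargs A))"

text \<open>A clause \<open>(A, [B\<^sub>1, \<dots>, B\<^sub>n])\<close> is the definite Horn clause \<open>A \<Leftarrow> B\<^sub>1, \<dots>, B\<^sub>n\<close>.
  A triple \<open>(s, t, c)\<close> is, depending on its use, the conditional equation \<open>s = t \<Leftarrow> c\<close>, the
  conditional rule \<open>s \<rightarrow> t \<Leftarrow> c\<close>, or the conditional pair \<open>\<langle>s, t\<rangle> \<Leftarrow> c\<close>.\<close>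

type_synonym ('p, 'f, 'v) clause = "('p, 'f, 'v) atom \<times> ('p, 'f, 'v) atom list"
type_synonym ('p, 'f, 'v) crule =
  "('f, 'v) trm \<times> ('f, 'v) trm \<times> ('p, 'f, 'v) atom list"

fun rule_vars :: "('p, 'f, 'v) crule \<Rightarrow> 'v set" where
  "rule_vars (s, t, c) = tvars s \<union> tvars t \<union> \<Union> (avars ` set c)"

fun rule_subst :: "('v \<Rightarrow> ('f, 'v) trm) \<Rightarrow> ('p, 'f, 'v) crule \<Rightarrow> ('p, 'f, 'v) crule" where
  "rule_subst \<sigma> (s, t, c) = (subst \<sigma> s, subst \<sigma> t, map (asubst \<sigma>) c)"

record ('p, 'f, 'v) egtrs =
  Fsig :: "'f set"
  far :: "'f \<Rightarrow> nat"
  Psig :: "'p set"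
  par :: "'p \<Rightarrow> nat"
  repl :: "'f \<Rightarrow> nat set"
  Eqs :: "('p, 'f, 'v) crule set"
  Hcl :: "('p, 'f, 'v) clause set"
  Rls :: "('p, 'f, 'v) crule set"

inductive_set terms :: "('p, 'f, 'v) egtrs \<Rightarrow> ('f, 'v) trm set" for \<R> where
  "Var x \<in> terms \<R>"
| "f \<in> Fsig \<R> \<Longrightarrow> length ts = far \<R> f \<Longrightarrow> \<forall>t \<in> set ts. t \<in> terms \<R> \<Longrightarrow> Fun f ts \<in> terms \<R>"

definition substs :: "('p, 'f, 'v) egtrs \<Rightarrow> ('v \<Rightarrow> ('f, 'v) trm) set" where
  "substs \<R> = {\<sigma>. \<forall>x. \<sigma> x \<in> terms \<R>}"

fun pred_arity :: "('p, 'f, 'v) egtrs \<Rightarrow> 'p psym \<Rightarrow> nat" where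
  "pred_arity \<R> (Usr P) = par \<R> P"
| "pred_arity \<R> _ = 2"

definition sig_preds :: "('p, 'f, 'v) egtrs \<Rightarrow> 'p psym set" where
  "sig_preds \<R> = {Eq, Rew, Rews, Approx} \<union> Usr ` Psig \<R>"

definition atoms :: "('p, 'f, 'v) egtrs \<Rightarrow> ('p, 'f, 'v) atom set" where
  "atoms \<R> = {A. apred A \<in> sig_preds \<R> \<and> length (aargs A) = pred_arity \<R> (apred A) \<and>
                 set (aargs A) \<subseteq> terms \<R>}"

inductive depends_on_R :: "('p, 'f, 'v) egtrs \<Rightarrow> 'p psym \<Rightarrow> bool" for \<R> where
  "depends_on_R \<R> Rew"
| "depends_on_R \<R> Rews"
| "(s, t, c) \<in> Eqs \<R> \<Longrightarrow> B \<in> set c \<Longrightarrow> depends_on_R \<R> (apred B) \<Longrightarrow> depends_on_R \<R> Eq"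
| "(A, c) \<in> Hcl \<R> \<Longrightarrow> B \<in> set c \<Longrightarrow> depends_on_R \<R> (apred B) \<Longrightarrow> depends_on_R \<R> (apred A)"

definition is_egtrs :: "('p, 'f, 'v) egtrs \<Rightarrow> bool" where
  "is_egtrs \<R> \<longleftrightarrow>
     (\<forall>f \<in> Fsig \<R>. repl \<R> f \<subseteq> {..<far \<R> f}) \<and>
     (\<forall>(s, t, c) \<in> Eqs \<R>. s \<in> terms \<R> \<and> t \<in> terms \<R> \<and> set c \<subseteq> atoms \<R>) \<and>
     (\<forall>(A, c) \<in> Hcl \<R>. A \<in> atoms \<R> \<and> set c \<subseteq> atoms \<R> \<and> apred A \<notin> {Eq, Rew, Rews}) \<and>
     (\<forall>(l, r, c) \<in> Rls \<R>. l \<in> terms \<R> \<and> r \<in> terms \<R> \<and> set c \<subseteq> atoms \<R> \<and> l \<notin> range Var) \<and>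
     \<not> depends_on_R \<R> Eq"

definition sym_rules :: "('p, 'f, 'v) egtrs \<Rightarrow> ('p, 'f, 'v) crule set" where
  "sym_rules \<R> = Eqs \<R> \<union> {(t, s, c) | s t c. (s, t, c) \<in> Eqs \<R>}"

text \<open>Replacing \<open>\<approx>\<close> by \<open>\<approx>\<^sub>r\<^sub>m\<close> in the rules and in the Horn clauses, but not in the equations, is
  meant for an \<open>\<approx>\<close> that is interpreted by rewriting, which then cannot occur in conditions
  of equations. If \<open>\<approx>\<close> does not depend on the rules, both symbols have the same meaning, and
  the replacement would only remove the clauses for an \<open>\<approx>\<close> occurring in equations (so that the
  equality of the theory below would no longer be the one generated by the equations);
  \<open>\<approx>\<close> is kept in this case.\<close>

fun rm_approx :: "('p, 'f, 'v) egtrs \<Rightarrow> 'p psym \<Rightarrow> 'p psym" where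
  "rm_approx \<R> Approx = (if depends_on_R \<R> Approx then ApproxRm else Approx)"
| "rm_approx \<R> P = P"

fun rm_all :: "('p, 'f, 'v) egtrs \<Rightarrow> 'p psym \<Rightarrow> 'p psym" where
  "rm_all \<R> Rew = RewRm"
| "rm_all \<R> Rews = RewsRm"
| "rm_all \<R> P = rm_approx \<R> P"

definition map_pred :: "('p psym \<Rightarrow> 'p psym) \<Rightarrow> ('p, 'f, 'v) atom \<Rightarrow> ('p, 'f, 'v) atom" where
  "map_pred h A = Atom (h (apred A)) (aargs A)"

definition Rls_rm :: "('p, 'f, 'v) egtrs \<Rightarrow> ('p, 'f, 'v) crule set" where
  "Rls_rm \<R> = {(l, r, map (map_pred (rm_approx \<R>)) c) | l r c. (l, r, c) \<in> Rls \<R>}"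

definition Hcl_rm :: "('p, 'f, 'v) egtrs \<Rightarrow> ('p, 'f, 'v) clause set" where
  "Hcl_rm \<R> = {(map_pred (rm_all \<R>) A, map (map_pred (rm_all \<R>)) c) | A c. (A, c) \<in> Hcl \<R>}"

text \<open>Clauses are read as their universal closures. An atom is deducible if it is obtained from
  instances of clauses by modus ponens; this is a sound and complete deduction procedure for
  definite Horn theories, see \<open>deducible_iff_consequence\<close> below.\<close>

inductive deducible ::
  "('p, 'f, 'v) egtrs \<Rightarrow> ('p, 'f, 'v) clause set \<Rightarrow> ('p, 'f, 'v) atom \<Rightarrow> bool"
  for \<R> Th where
  "(A, c) \<in> Th \<Longrightarrow> \<sigma> \<in> substs \<R> \<Longrightarrow> \<forall>B \<in> set c. deducible \<R> Th (asubst \<sigma> B)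
    \<Longrightarrow> deducible \<R> Th (asubst \<sigma> A)"

primrec eval :: "('f \<Rightarrow> 'd list \<Rightarrow> 'd) \<Rightarrow> ('v \<Rightarrow> 'd) \<Rightarrow> ('f, 'v) trm \<Rightarrow> 'd" where
  "eval I \<nu> (Var x) = \<nu> x"
| "eval I \<nu> (Fun f ts) = I f (map (eval I \<nu>) ts)"

definition holds ::
  "('f \<Rightarrow> 'd list \<Rightarrow> 'd) \<Rightarrow> ('p psym \<Rightarrow> 'd list \<Rightarrow> bool) \<Rightarrow> ('v \<Rightarrow> 'd) \<Rightarrow> ('p, 'f, 'v) atom \<Rightarrow> bool"
where
  "holds I J \<nu> A \<longleftrightarrow> J (apred A) (map (eval I \<nu>) (aargs A))"

definition is_structure ::
  "('p, 'f, 'v) egtrs \<Rightarrow> 'd set \<Rightarrow> ('f \<Rightarrow> 'd list \<Rightarrow> 'd) \<Rightarrow> bool" where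
  "is_structure \<R> D I \<longleftrightarrow> D \<noteq> {} \<and>
     (\<forall>f \<in> Fsig \<R>. \<forall>ds. length ds = far \<R> f \<and> set ds \<subseteq> D \<longrightarrow> I f ds \<in> D)"

definition is_model ::
  "('p, 'f, 'v) egtrs \<Rightarrow> ('p, 'f, 'v) clause set \<Rightarrow> 'd set \<Rightarrow> ('f \<Rightarrow> 'd list \<Rightarrow> 'd) \<Rightarrow>
   ('p psym \<Rightarrow> 'd list \<Rightarrow> bool) \<Rightarrow> bool" where
  "is_model \<R> Th D I J \<longleftrightarrow> is_structure \<R> D I \<and>
     (\<forall>(A, c) \<in> Th. \<forall>\<nu>. range \<nu> \<subseteq> D \<longrightarrow> (\<forall>B \<in> set c. holds I J \<nu> B) \<longrightarrow> holds I J \<nu> A)"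

lemma eval_subst: "eval I \<nu> (subst \<sigma> t) = eval I (\<lambda>x. eval I \<nu> (\<sigma> x)) t"
  by (induction t) (auto simp: comp_def cong: map_cong)

lemma eval_closed:
  assumes "t \<in> terms \<R>" "is_structure \<R> D I" "range \<nu> \<subseteq> D"
  shows "eval I \<nu> t \<in> D"
  using assms(1)
proof induction
  case (2 f ts)
  then have "set (map (eval I \<nu>) ts) \<subseteq> D" by auto
  with 2 assms(2) show ?case by (simp add: is_structure_def)
qed (use assms(3) in auto)

lemma holds_asubst: "holds I J \<nu> (asubst \<sigma> A) = holds I J (\<lambda>x. eval I \<nu> (\<sigma> x)) A"
  by (simp add: holds_def asubst_def comp_def eval_subst)

lemma deducible_sound:
  assumes "deducible \<R> Th A" "is_model \<R> Th D I J" "range \<nu> \<subseteq> D"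
  shows "holds I J \<nu> A"
  using assms(1)
proof induction
  case (1 A c \<sigma>)
  let ?\<nu> = "\<lambda>x. eval I \<nu> (\<sigma> x)"
  have "range ?\<nu> \<subseteq> D"
    using 1 assms by (auto simp: substs_def is_model_def intro: eval_closed)
  moreover have "\<forall>B \<in> set c. holds I J ?\<nu> B"
    using 1 by (simp add: holds_asubst)
  ultimately have "holds I J ?\<nu> A"
    using 1(1) assms(2) unfolding is_model_def by blast
  then show ?case by (simp add: holds_asubst)
qed

lemma eval_Fun: "eval Fun \<sigma> t = subst \<sigma> t"
  by (induction t) (auto cong: map_cong)

lemma subst_Var: "subst Var t = t"
  by (induction t) (auto simp: map_idI)

lemma deducible_iff_consequence:
  fixes \<R> :: "('p, 'f, 'v) egtrs"
  shows "deducible \<R> Th A \<longleftrightarrow>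
    (\<forall>(D :: ('f, 'v) trm set) I J \<nu>. is_model \<R> Th D I J \<and> range \<nu> \<subseteq> D \<longrightarrow> holds I J \<nu> A)"
    (is "_ \<longleftrightarrow> ?cons")
proof
  show "deducible \<R> Th A \<Longrightarrow> ?cons" by (blast intro: deducible_sound)
next
  assume cons: ?cons
  define J where "J = (\<lambda>P ts. deducible \<R> Th (Atom P ts))"
  have holds: "holds Fun J \<sigma> B \<longleftrightarrow> deducible \<R> Th (asubst \<sigma> B)"
    for \<sigma> :: "'v \<Rightarrow> ('f, 'v) trm" and B
    by (simp add: holds_def J_def asubst_def eval_Fun[abs_def])
  have "is_structure \<R> (terms \<R>) Fun"
    by (auto simp: is_structure_def intro: terms.intros)
  then have "is_model \<R> Th (terms \<R>) Fun J"
    unfolding is_model_def holds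
    by (auto simp: substs_def image_subset_iff simp del: subst.simps intro: deducible.intros)
  moreover have "range Var \<subseteq> terms \<R>" by (auto intro: terms.intros)
  ultimately have "holds Fun J Var A" using cons by blast
  then show "deducible \<R> Th A"
    by (simp add: holds asubst_def subst_Var[abs_def])
qed

definition refl_ax :: "'p psym \<Rightarrow> ('p, 'f, 'v) clause set" where
  "refl_ax P = {(bin P (Var x) (Var x), []) | x. True}"

definition sym_ax :: "'p psym \<Rightarrow> ('p, 'f, 'v) clause set" where
  "sym_ax P = {(bin P (Var y) (Var x), [bin P (Var x) (Var y)]) | x y. x \<noteq> y}"

text \<open>\<open>x P y \<and> y Q z \<Longrightarrow> x Q z\<close>\<close>

definition trans_ax :: "'p psym \<Rightarrow> 'p psym \<Rightarrow> ('p, 'f, 'v) clause set" where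
  "trans_ax P Q =
     {(bin Q (Var x) (Var z), [bin P (Var x) (Var y), bin Q (Var y) (Var z)]) | x y z.
        distinct [x, y, z]}"

definition prop_ax :: "('p, 'f, 'v) egtrs \<Rightarrow> 'p psym \<Rightarrow> ('p, 'f, 'v) clause set" where
  "prop_ax \<R> P =
     {(bin P (Fun f (map Var xs)) (Fun f (map Var (xs[i := y]))), [bin P (Var (xs ! i)) (Var y)])
      | f i xs y. f \<in> Fsig \<R> \<and> i \<in> repl \<R> f \<and> length xs = far \<R> f \<and> distinct (y # xs)}"

definition rule_ax :: "'p psym \<Rightarrow> ('p, 'f, 'v) crule set \<Rightarrow> ('p, 'f, 'v) clause set" where
  "rule_ax P rs = {(bin P l r, c) | l r c. (l, r, c) \<in> rs}"

definition modulo_rule_ax :: "'p psym \<Rightarrow> ('p, 'f, 'v) crule set \<Rightarrow> ('p, 'f, 'v) clause set" where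
  "modulo_rule_ax P rs =
     {(bin P (Var x) r, bin Eq (Var x) l # c) | x l r c.
        (l, r, c) \<in> rs \<and> x \<notin> rule_vars (l, r, c)}"

definition eq_ax :: "('p, 'f, 'v) egtrs \<Rightarrow> ('p, 'f, 'v) clause set" where
  "eq_ax \<R> = refl_ax Eq \<union> sym_ax Eq \<union> trans_ax Eq Eq \<union> prop_ax \<R> Eq \<union> rule_ax Eq (Eqs \<R>)"

definition rew_ax ::
  "('p, 'f, 'v) egtrs \<Rightarrow> ('p, 'f, 'v) crule set \<Rightarrow> ('p, 'f, 'v) clause set" where
  "rew_ax \<R> rs = refl_ax Rews \<union> trans_ax Rew Rews \<union> prop_ax \<R> Rew \<union> rule_ax Rew rs"

definition ps_ax :: "('p, 'f, 'v) egtrs \<Rightarrow> ('p, 'f, 'v) clause set" where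
  "ps_ax \<R> =
     refl_ax RewsPs \<union> trans_ax RewPs RewsPs \<union> prop_ax \<R> RewPs \<union> modulo_rule_ax RewPs (Rls_rm \<R>)"

definition rm_ax :: "('p, 'f, 'v) clause set" where
  "rm_ax = refl_ax RewsRm \<union> trans_ax RewRm RewsRm \<union>
     {(bin RewRm (Var x) (Var y),
       [bin Eq (Var x) (Var x'), bin Rew (Var x') (Var y'), bin Eq (Var y') (Var y)])
      | x x' y' y. distinct [x, x', y', y]}"

definition Th_CR :: "('p, 'f, 'v) egtrs \<Rightarrow> ('p, 'f, 'v) clause set" where
  "Th_CR \<R> = eq_ax \<R> \<union> rew_ax \<R> (Rls_rm \<R>) \<union> ps_ax \<R> \<union> rm_ax \<union> Hcl_rm \<R>"

definition step_R :: "('p, 'f, 'v) egtrs \<Rightarrow> ('f, 'v) trm \<Rightarrow> ('f, 'v) trm \<Rightarrow> bool" where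
  "step_R \<R> s t \<longleftrightarrow> deducible \<R> (Th_CR \<R>) (bin Rew s t)"

definition step_RE :: "('p, 'f, 'v) egtrs \<Rightarrow> ('f, 'v) trm \<Rightarrow> ('f, 'v) trm \<Rightarrow> bool" where
  "step_RE \<R> s t \<longleftrightarrow> deducible \<R> (Th_CR \<R>) (bin RewPs s t)"

definition step_RmodE :: "('p, 'f, 'v) egtrs \<Rightarrow> ('f, 'v) trm \<Rightarrow> ('f, 'v) trm \<Rightarrow> bool" where
  "step_RmodE \<R> s t \<longleftrightarrow> deducible \<R> (Th_CR \<R>) (bin RewRm s t)"

definition eq_E :: "('p, 'f, 'v) egtrs \<Rightarrow> ('f, 'v) trm \<Rightarrow> ('f, 'v) trm \<Rightarrow> bool" where
  "eq_E \<R> s t \<longleftrightarrow> deducible \<R> (eq_ax \<R> \<union> Hcl \<R>) (bin Eq s t)"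

definition step_E :: "('p, 'f, 'v) egtrs \<Rightarrow> ('f, 'v) trm \<Rightarrow> ('f, 'v) trm \<Rightarrow> bool" where
  "step_E \<R> s t \<longleftrightarrow> deducible \<R> (rew_ax \<R> (sym_rules \<R>)) (bin Rew s t)"

definition E_terminating :: "('p, 'f, 'v) egtrs \<Rightarrow> bool" where
  "E_terminating \<R> \<longleftrightarrow> \<not> (\<exists>t. \<forall>i::nat. step_RmodE \<R> (t i) (t (Suc i)))"

definition E_confluent :: "('p, 'f, 'v) egtrs \<Rightarrow> bool" where
  "E_confluent \<R> \<longleftrightarrow>
     (\<forall>t \<in> terms \<R>. \<forall>t1 t2. (step_RmodE \<R>)\<^sup>*\<^sup>* t t1 \<and> (step_RmodE \<R>)\<^sup>*\<^sup>* t t2 \<longrightarrow>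
        (\<exists>t1' t2'. (step_RmodE \<R>)\<^sup>*\<^sup>* t1 t1' \<and> (step_RmodE \<R>)\<^sup>*\<^sup>* t2 t2' \<and> eq_E \<R> t1' t2'))"

definition RE_joinable :: "('p, 'f, 'v) egtrs \<Rightarrow> ('f, 'v) trm \<Rightarrow> ('f, 'v) trm \<Rightarrow> bool" where
  "RE_joinable \<R> s t \<longleftrightarrow>
     (\<exists>u u'. (step_RE \<R>)\<^sup>*\<^sup>* s u \<and> (step_RE \<R>)\<^sup>*\<^sup>* t u' \<and> eq_E \<R> u u')"

definition church_rosser_mod_E :: "('p, 'f, 'v) egtrs \<Rightarrow> bool" where
  "church_rosser_mod_E \<R> \<longleftrightarrow>
     (\<forall>t \<in> terms \<R>. \<forall>t' \<in> terms \<R>.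
        (sup (step_E \<R>) (sup (step_R \<R>) (step_R \<R>)\<inverse>\<inverse>))\<^sup>*\<^sup>* t t' \<longrightarrow> RE_joinable \<R> t t')"

fun pair_joinable :: "('p, 'f, 'v) egtrs \<Rightarrow> ('p, 'f, 'v) crule \<Rightarrow> bool" where
  "pair_joinable \<R> (s, t, c) \<longleftrightarrow>
     (\<forall>\<sigma> \<in> substs \<R>. (\<forall>A \<in> set c. deducible \<R> (Th_CR \<R>) (asubst \<sigma> A)) \<longrightarrow>
        RE_joinable \<R> (subst \<sigma> s) (subst \<sigma> t))"

definition variants :: "('p, 'f, 'v) crule set \<Rightarrow> ('p, 'f, 'v) crule set" where
  "variants rs = {rule_subst (Var \<circ> \<pi>) \<alpha> | \<pi> \<alpha>. bij \<pi> \<and> \<alpha> \<in> rs}"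

text \<open>The second rule is taken up to renaming, so that variable-disjointness can be achieved for
  any two rules, in particular for two copies of the same rule.\<close>

definition lccps ::
  "('p, 'f, 'v) egtrs \<Rightarrow> ('p, 'f, 'v) crule set \<Rightarrow> ('p, 'f, 'v) crule set \<Rightarrow> ('p, 'f, 'v) crule set"
where
  "lccps \<R> rs rs' =
     {(replace_at s p v, t, bin Eq (subt_at s p) u # c @ d) | s t c u v d p.
        (s, t, c) \<in> rs \<and> (u, v, d) \<in> variants rs' \<and>
        rule_vars (s, t, c) \<inter> rule_vars (u, v, d) = {} \<and>
        p \<in> active_fun_pos (repl \<R>) s}"

definition cvps_ps ::
  "('p, 'f, 'v) egtrs \<Rightarrow> ('p, 'f, 'v) crule set \<Rightarrow> ('p, 'f, 'v) crule set" where
  "cvps_ps \<R> rs =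
     {(replace_at s p (Var x'), t, bin RewPs (Var x) (Var x') # c) | s t c x x' p.
        (s, t, c) \<in> rs \<and> x \<in> active_vars (repl \<R>) s \<and> p \<in> active_var_pos (repl \<R>) x s \<and>
        x' \<notin> rule_vars (s, t, c)}"

definition LCCP_R :: "('p, 'f, 'v) egtrs \<Rightarrow> ('p, 'f, 'v) crule set" where
  "LCCP_R \<R> = lccps \<R> (Rls_rm \<R>) (Rls_rm \<R>)"

definition LCCP_E_R :: "('p, 'f, 'v) egtrs \<Rightarrow> ('p, 'f, 'v) crule set" where
  "LCCP_E_R \<R> = lccps \<R> (sym_rules \<R>) (Rls_rm \<R>)"

definition CVP_ps_R :: "('p, 'f, 'v) egtrs \<Rightarrow> ('p, 'f, 'v) crule set" where
  "CVP_ps_R \<R> = cvps_ps \<R> (Rls_rm \<R>)"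

definition CVP_ps_E :: "('p, 'f, 'v) egtrs \<Rightarrow> ('p, 'f, 'v) crule set" where
  "CVP_ps_E \<R> = cvps_ps \<R> (sym_rules \<R>)"

end

theory Submission
  imports Defs
begin

text \<open>
  One-step equalities and rewrite steps modulo \<open>E\<close> are closures of instances of (conditional)
  equations and rules under active contexts, with all conditions evaluated in the same theory.
  If a term \<open>\<sigma>(l)\<close> is rewritten at the root by a rule or an equation, and anywhere modulo \<open>E\<close>, the
  peak is an instance of an LCCP or of a CVP, hence joinable. The remaining problematic peak is a
  step modulo \<open>E\<close> at the root, \<open>s =\<^sub>E \<sigma>(l) \<rightarrow> \<sigma>(r)\<close>, against a plain step \<open>s \<rightarrow> e\<close> strictly below:
  here the step \<open>s \<rightarrow> e\<close> is transported along the equational chain from \<open>s\<close> to \<open>\<sigma>(l)\<close>, using that an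
  equational step against a step modulo \<open>E\<close> is joinable and, by termination, not without rewriting
  the other side. The intermediate joins are glued by well-founded induction on rewriting
  modulo \<open>E\<close>.
\<close>

section \<open>Fresh variables and renamings\<close>

lemma ex_distinct_avoiding:
  assumes "finite (A :: 'v :: infinite set)"
  shows "\<exists>xs. distinct xs \<and> length xs = n \<and> set xs \<inter> A = {}"
proof -
  have "infinite (UNIV - A)" using assms by (simp add: infinite_UNIV)
  then obtain B where B: "finite B" "card B = n" "B \<subseteq> UNIV - A"
    using infinite_arbitrarily_large by blast
  then obtain xs where "set xs = B" "distinct xs" using finite_distinct_list by blast
  with B show ?thesis using distinct_card by fastforce
qed

text \<open>Swapping \<open>B\<close> with a set of the same size that avoids both \<open>A\<close>
  and \<open>B\<close> gives an involution, hence a bijection. Such a \<open>\<pi>\<close> renames a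
  rule apart from another one.\<close>

lemma ex_bij_avoiding:
  assumes "finite A" "finite B"
  shows "\<exists>\<pi> :: 'v :: infinite \<Rightarrow> 'v. bij \<pi> \<and> \<pi> ` B \<inter> A = {}"
proof -
  obtain ys where ys: "distinct ys" "length ys = card B" "set ys \<inter> (A \<union> B) = {}"
    using ex_distinct_avoiding[of "A \<union> B"] assms by blast
  then have "card B = card (set ys)" by (simp add: distinct_card)
  then obtain h where h: "bij_betw h B (set ys)"
    using assms(2) finite_same_card_bij by blast
  define g where "g = inv_into B h"
  have g: "bij_betw g (set ys) B" using h by (simp add: g_def bij_betw_inv_into)
  have gh: "g (h x) = x" if "x \<in> B" for x
    using h that by (simp add: g_def bij_betw_def)
  have hg: "h (g y) = y" if "y \<in> set ys" for y
    using h that by (simp add: g_def bij_betw_inv_into_right)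
  have hB: "h x \<in> set ys" if "x \<in> B" for x using h that by (auto simp: bij_betw_def)
  have gB: "g y \<in> B" if "y \<in> set ys" for y using g that by (auto simp: bij_betw_def)
  define \<pi> where "\<pi> z = (if z \<in> B then h z else if z \<in> set ys then g z else z)" for z
  have "\<pi> (\<pi> z) = z" for z
    using ys(3) gh hg hB gB by (auto simp: \<pi>_def)
  then have "bij \<pi>" by (metis bijI')
  moreover have "\<pi> ` B \<inter> A = {}" using ys(3) hB by (auto simp: \<pi>_def)
  ultimately show ?thesis by blast
qed

section \<open>Substitutions, variables and positions\<close>

lemma subst_cong: "(\<And>x. x \<in> tvars t \<Longrightarrow> \<sigma> x = \<tau> x) \<Longrightarrow> subst \<sigma> t = subst \<tau> t"
  by (induction t) auto

lemma subst_subst: "subst \<sigma> (subst \<tau> t) = subst (\<lambda>x. subst \<sigma> (\<tau> x)) t"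
  by (induction t) auto

lemma asubst_cong: "(\<And>x. x \<in> avars A \<Longrightarrow> \<sigma> x = \<tau> x) \<Longrightarrow> asubst \<sigma> A = asubst \<tau> A"
  by (auto simp: asubst_def avars_def intro!: subst_cong)

lemma asubst_asubst: "asubst \<sigma> (asubst \<tau> A) = asubst (\<lambda>x. subst \<sigma> (\<tau> x)) A"
  by (simp add: asubst_def subst_subst)

lemma asubst_bin: "asubst \<sigma> (bin P s t) = bin P (subst \<sigma> s) (subst \<sigma> t)"
  by (simp add: asubst_def)

lemma finite_tvars: "finite (tvars t)"
  by (induction t) auto

lemma finite_rule_vars: "finite (rule_vars \<alpha>)"
  by (cases \<alpha>) (auto simp: finite_tvars avars_def)

lemma tvars_subst_Var: "tvars (subst (Var \<circ> \<pi>) t) = \<pi> ` tvars t"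
  by (induction t) auto

lemma avars_asubst_Var: "avars (asubst (Var \<circ> \<pi>) A) = \<pi> ` avars A"
  by (auto simp: avars_def asubst_def tvars_subst_Var)

lemma rule_vars_subst_Var: "rule_vars (rule_subst (Var \<circ> \<pi>) \<alpha>) = \<pi> ` rule_vars \<alpha>"
  by (cases \<alpha>) (auto simp: tvars_subst_Var avars_asubst_Var image_Un image_UN)

lemma subst_in_terms: "t \<in> terms \<R> \<Longrightarrow> \<sigma> \<in> substs \<R> \<Longrightarrow> subst \<sigma> t \<in> terms \<R>"
  by (induction t rule: terms.induct) (auto simp: substs_def intro!: terms.intros)

lemma Fun_in_terms_iff:
  "Fun f ts \<in> terms \<R> \<longleftrightarrow> f \<in> Fsig \<R> \<and> length ts = far \<R> f \<and> set ts \<subseteq> terms \<R>"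
  by (auto elim: terms.cases intro: terms.intros)

lemma tvars_subt_at: "p \<in> active_pos \<mu> t \<Longrightarrow> tvars (subt_at t p) \<subseteq> tvars t"
  by (induction t p rule: subt_at.induct) fastforce+

lemma subst_replace_at:
  "p \<in> active_pos \<mu> t \<Longrightarrow> subst \<sigma> (replace_at t p u) = replace_at (subst \<sigma> t) p (subst \<sigma> u)"
  by (induction t p u rule: replace_at.induct) (auto simp: map_update)

section \<open>Closure under active contexts\<close>

text \<open>The base relation \<open>B\<close> is a parameter because plain rewriting, rewriting
  modulo the equations and single equational steps are all obtained as such closures.\<close>

inductive act_closure ::
  "('p, 'f, 'v) egtrs \<Rightarrow> (('f, 'v) trm \<Rightarrow> ('f, 'v) trm \<Rightarrow> bool) \<Rightarrow> ('f, 'v) trm \<Rightarrow> ('f, 'v) trm \<Rightarrow> bool"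
  for \<R> B where
  root: "B s t \<Longrightarrow> act_closure \<R> B s t"
| arg: "Fun f ts \<in> terms \<R> \<Longrightarrow> i \<in> repl \<R> f \<Longrightarrow> act_closure \<R> B (ts ! i) t
    \<Longrightarrow> act_closure \<R> B (Fun f ts) (Fun f (ts[i := t]))"

lemma act_closure_mono:
  "act_closure \<R> B s t \<Longrightarrow> (\<And>s t. B s t \<Longrightarrow> B' s t) \<Longrightarrow> act_closure \<R> B' s t"
  by (induction rule: act_closure.induct) (auto intro: act_closure.intros)

inductive act_subterm :: "('p, 'f, 'v) egtrs \<Rightarrow> ('f, 'v) trm \<Rightarrow> ('f, 'v) trm \<Rightarrow> bool" for \<R> where
  refl: "act_subterm \<R> t t"
| arg: "Fun f ts \<in> terms \<R> \<Longrightarrow> i \<in> repl \<R> f \<Longrightarrow> act_subterm \<R> (ts ! i) u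
    \<Longrightarrow> act_subterm \<R> (Fun f ts) u"

section \<open>Shape of the clauses of the theory\<close>

locale wf_egtrs =
  fixes \<R> :: "('p, 'f, 'v :: infinite) egtrs"
  assumes wf: "is_egtrs \<R>"
begin

abbreviation "ded \<equiv> deducible \<R> (Th_CR \<R>)"
abbreviation "equal s t \<equiv> ded (bin Eq s t)"

lemma repl_less: "Fun f ts \<in> terms \<R> \<Longrightarrow> i \<in> repl \<R> f \<Longrightarrow> i < length ts"
  using wf by (auto simp: is_egtrs_def Fun_in_terms_iff)

lemma Hcl_wf:
  assumes "(A, c) \<in> Hcl \<R>"
  shows "set (aargs A) \<subseteq> terms \<R>" "apred A \<in> {Approx} \<union> range Usr" "apred A \<in> sig_preds \<R>"
    "\<And>B. B \<in> set c \<Longrightarrow> apred B \<in> sig_preds \<R>"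
  using wf assms by (auto simp: is_egtrs_def atoms_def sig_preds_def)

lemma Eqs_wf:
  assumes "(s, t, c) \<in> Eqs \<R>"
  shows "s \<in> terms \<R>" "t \<in> terms \<R>" "\<And>B. B \<in> set c \<Longrightarrow> apred B \<in> sig_preds \<R>"
  using wf assms by (auto simp: is_egtrs_def atoms_def)

lemma Rls_rm_wf: "(l, r, c) \<in> Rls_rm \<R> \<Longrightarrow> l \<in> terms \<R> \<and> r \<in> terms \<R>"
  using wf by (auto simp: is_egtrs_def Rls_rm_def)

lemma sym_rules_wf: "(l, r, c) \<in> sym_rules \<R> \<Longrightarrow> l \<in> terms \<R> \<and> r \<in> terms \<R>"
  by (auto simp: sym_rules_def dest: Eqs_wf)

text \<open>The heads in \<open>Hcl\<close> avoid \<open>Eq\<close>, \<open>Rew\<close> and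
  \<open>Rews\<close>, and the renaming can only add \<open>ApproxRm\<close>. User clauses therefore
  never conclude an equality or a rewriting atom, so deductions of those can be inverted by head
  predicate.\<close>

lemma Hcl_rm_head:
  assumes "(A, c) \<in> Hcl_rm \<R>"
  shows "apred A \<in> {Approx, ApproxRm} \<union> range Usr" "set (aargs A) \<subseteq> terms \<R>"
  using assms Hcl_wf(1,2) by (fastforce simp: Hcl_rm_def map_pred_def)+

lemma head_preds:
  "(A, c) \<in> refl_ax P \<Longrightarrow> apred A = P"
  "(A, c) \<in> sym_ax P \<Longrightarrow> apred A = P"
  "(A, c) \<in> trans_ax Q P \<Longrightarrow> apred A = P"
  "(A, c) \<in> prop_ax \<R> P \<Longrightarrow> apred A = P"
  "(A, c) \<in> rule_ax P rs \<Longrightarrow> apred A = P"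
  "(A, c) \<in> modulo_rule_ax P rs \<Longrightarrow> apred A = P"
  by (auto simp: refl_ax_def sym_ax_def trans_ax_def prop_ax_def rule_ax_def modulo_rule_ax_def)

lemma Th_CR_Eq_head: "(A, c) \<in> Th_CR \<R> \<Longrightarrow> apred A = Eq \<Longrightarrow> (A, c) \<in> eq_ax \<R>"
  by (auto simp: Th_CR_def rew_ax_def ps_ax_def rm_ax_def dest: head_preds Hcl_rm_head(1))

lemma Th_CR_Rew_head:
  "(A, c) \<in> Th_CR \<R> \<Longrightarrow> apred A = Rew \<Longrightarrow> (A, c) \<in> prop_ax \<R> Rew \<union> rule_ax Rew (Rls_rm \<R>)"
  by (auto simp: Th_CR_def eq_ax_def rew_ax_def ps_ax_def rm_ax_def
      dest: head_preds Hcl_rm_head(1))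

lemma Th_CR_RewPs_head:
  "(A, c) \<in> Th_CR \<R> \<Longrightarrow> apred A = RewPs
    \<Longrightarrow> (A, c) \<in> prop_ax \<R> RewPs \<union> modulo_rule_ax RewPs (Rls_rm \<R>)"
  by (auto simp: Th_CR_def eq_ax_def rew_ax_def ps_ax_def rm_ax_def
      dest: head_preds Hcl_rm_head(1))

lemma Th_CR_RewRm_head:
  "(A, c) \<in> Th_CR \<R> \<Longrightarrow> apred A = RewRm \<Longrightarrow> \<exists>x x' y' y. A = bin RewRm (Var x) (Var y) \<and>
     c = [bin Eq (Var x) (Var x'), bin Rew (Var x') (Var y'), bin Eq (Var y') (Var y)]"
  by (auto simp: Th_CR_def eq_ax_def rew_ax_def ps_ax_def rm_ax_def
      dest: head_preds Hcl_rm_head(1))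

lemma Th_CR_nondep_head:
  "(A, c) \<in> Th_CR \<R> \<Longrightarrow> apred A \<in> sig_preds \<R> \<Longrightarrow> \<not> depends_on_R \<R> (apred A)
    \<Longrightarrow> (A, c) \<in> eq_ax \<R> \<union> Hcl_rm \<R>"
  by (auto simp: Th_CR_def rew_ax_def ps_ax_def rm_ax_def sig_preds_def
      dest: head_preds intro: depends_on_R.intros)

lemma Th_CR_head_terms:
  assumes "(A, c) \<in> Th_CR \<R>" shows "set (aargs A) \<subseteq> terms \<R>"
proof (cases "(A, c) \<in> Hcl_rm \<R>")
  case False
  have prop_ax: "(A, c) \<in> prop_ax \<R> P \<Longrightarrow> ?thesis" for P
    by (auto simp: prop_ax_def Fun_in_terms_iff terms.intros(1))
  show ?thesis using assms False
    unfolding Th_CR_def eq_ax_def rew_ax_def ps_ax_def rm_ax_def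
    by (elim UnE)
      (auto simp: refl_ax_def sym_ax_def trans_ax_def rule_ax_def modulo_rule_ax_def
        dest: Eqs_wf Rls_rm_wf intro: terms.intros prop_ax[THEN subsetD])
qed (simp add: Hcl_rm_head)

text \<open>Deductions use only substitutions into \<open>terms\<close>, and all clause heads are
  built from well-formed terms. Well-formedness can thus be read off any deducible atom.\<close>

lemma ded_terms: "ded A \<Longrightarrow> set (aargs A) \<subseteq> terms \<R>"
proof (induction rule: deducible.induct)
  case (1 A c \<sigma>)
  then show ?case using Th_CR_head_terms[of A c] by (auto simp: asubst_def intro: subst_in_terms)
qed

lemma ded_bin_terms: "ded (bin P s t) \<Longrightarrow> s \<in> terms \<R> \<and> t \<in> terms \<R>"
  using ded_terms by fastforce

lemma ded_intro:
  "(A, c) \<in> Th_CR \<R> \<Longrightarrow> \<sigma> \<in> substs \<R> \<Longrightarrow> (\<And>B. B \<in> set c \<Longrightarrow> ded (asubst \<sigma> B))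
    \<Longrightarrow> asubst \<sigma> A = A' \<Longrightarrow> ded A'"
  by (metis deducible.intros)

section \<open>Two descriptions of equality modulo the equations\<close>

text \<open>\<open>eq_E\<close> uses the clauses \<open>Hcl\<close>, whereas \<open>Th_CR\<close>
  contains the renamed \<open>Hcl_rm\<close>. A deduction of an equality only passes through
  predicates that do not depend on the rules, and on these the renaming is the identity, so
  deductions carry over in both directions.\<close>

lemma eq_E_iff: "eq_E \<R> s t \<longleftrightarrow> equal s t"
proof -
  have nEq: "\<not> depends_on_R \<R> Eq" using wf by (simp add: is_egtrs_def)
  have bodyE: "apred B \<in> sig_preds \<R> \<and> \<not> depends_on_R \<R> (apred B)"
    if "(A, c) \<in> eq_ax \<R>" "B \<in> set c" for A c B
    using that nEq
    by (auto simp: eq_ax_def refl_ax_def sym_ax_def trans_ax_def prop_ax_def rule_ax_def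
        sig_preds_def dest: Eqs_wf(3) intro: depends_on_R.intros)
  have bodyH: "apred B \<in> sig_preds \<R> \<and> \<not> depends_on_R \<R> (apred B)"
    if "(A, c) \<in> Hcl \<R>" "\<not> depends_on_R \<R> (apred A)" "B \<in> set c" for A c B
    using that Hcl_wf(4) by (auto intro: depends_on_R.intros)
  have rm: "map_pred (rm_all \<R>) B = B"
    if "apred B \<in> sig_preds \<R>" "\<not> depends_on_R \<R> (apred B)" for B :: "('p, 'f, 'v) atom"
    using that
    by (cases B; cases "apred B") (auto simp: map_pred_def sig_preds_def depends_on_R.intros)
  have rmH: "(A, c) \<in> Hcl_rm \<R>" if "(A, c) \<in> Hcl \<R>" "\<not> depends_on_R \<R> (apred A)" for A c
  proof -
    have "map (map_pred (rm_all \<R>)) c = c" using rm bodyH[OF that] by (intro map_idI) blast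
    moreover have "map_pred (rm_all \<R>) A = A" using rm that Hcl_wf(3) by blast
    ultimately show ?thesis using that(1) by (force simp: Hcl_rm_def)
  qed
  \<comment> \<open>If the original head did depend on the rules, it would be either left unchanged
    or turned into \<open>ApproxRm\<close>. Both contradict the assumptions on
    \<open>A\<close>.\<close>
  have Hrm: "(A, c) \<in> Hcl \<R>"
    if "(A, c) \<in> Hcl_rm \<R>" "apred A \<in> sig_preds \<R>" "\<not> depends_on_R \<R> (apred A)" for A c
  proof -
    from that obtain A0 c0 where *: "(A0, c0) \<in> Hcl \<R>" "A = map_pred (rm_all \<R>) A0"
      "c = map (map_pred (rm_all \<R>)) c0" by (auto simp: Hcl_rm_def)
    have "\<not> depends_on_R \<R> (apred A0)"
      using Hcl_wf(2)[OF *(1)] that(2,3) *(2)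
      by (auto simp: map_pred_def sig_preds_def split: if_splits)
    then have "map_pred (rm_all \<R>) A0 = A0" "map (map_pred (rm_all \<R>)) c0 = c0"
      using rm bodyH[OF *(1)] Hcl_wf(3)[OF *(1)] by (auto intro!: map_idI)
    with * show ?thesis by simp
  qed
  have "deducible \<R> (eq_ax \<R> \<union> Hcl \<R>) A \<Longrightarrow> \<not> depends_on_R \<R> (apred A) \<Longrightarrow> ded A" for A
  proof (induction rule: deducible.induct)
    case (1 A c \<sigma>)
    then have nd: "\<not> depends_on_R \<R> (apred A)" by (simp add: asubst_def)
    then have "(A, c) \<in> Th_CR \<R>" using 1(1) rmH by (auto simp: Th_CR_def)
    moreover have "ded (asubst \<sigma> B)" if "B \<in> set c" for B
    proof -
      have "\<not> depends_on_R \<R> (apred (asubst \<sigma> B))"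
        using 1(1) nd that bodyE bodyH unfolding asubst_def atom.sel by blast
      with 1(3) that show ?thesis by blast
    qed
    ultimately show ?case using 1(2) by (simp add: deducible.intros)
  qed
  \<comment> \<open>Membership in \<open>sig_preds\<close> excludes the auxiliary predicates such as
    \<open>RewRm\<close>, which \<open>depends_on_R\<close> does not cover.\<close>
  moreover have "ded A \<Longrightarrow> apred A \<in> sig_preds \<R> \<Longrightarrow> \<not> depends_on_R \<R> (apred A)
    \<Longrightarrow> deducible \<R> (eq_ax \<R> \<union> Hcl \<R>) A" for A
  proof (induction rule: deducible.induct)
    case (1 A c \<sigma>)
    then have nd: "\<not> depends_on_R \<R> (apred A)" "apred A \<in> sig_preds \<R>"
      by (simp_all add: asubst_def)
    then have in_Th: "(A, c) \<in> eq_ax \<R> \<union> Hcl \<R>"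
      using Th_CR_nondep_head[OF 1(1)] Hrm by blast
    moreover have "deducible \<R> (eq_ax \<R> \<union> Hcl \<R>) (asubst \<sigma> B)" if "B \<in> set c" for B
    proof -
      have "apred (asubst \<sigma> B) \<in> sig_preds \<R> \<and> \<not> depends_on_R \<R> (apred (asubst \<sigma> B))"
        using in_Th nd that bodyE bodyH unfolding asubst_def atom.sel by blast
      with 1(3) that show ?thesis by blast
    qed
    ultimately show ?case using 1(2) by (simp add: deducible.intros)
  qed
  ultimately show ?thesis using nEq by (auto simp: eq_E_def sig_preds_def)
qed

section \<open>Propagation and the equivalence laws\<close>

lemma ded_prop:
  assumes P: "P \<in> {Eq, Rew, RewPs}"
    and f: "Fun f ts \<in> terms \<R>" "i \<in> repl \<R> f" and d: "ded (bin P (ts ! i) t)"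
  shows "ded (bin P (Fun f ts) (Fun f (ts[i := t])))"
proof -
  obtain zs :: "'v list" where zs: "distinct zs" "length zs = Suc (length ts)"
    using ex_distinct_avoiding[of "{}"] by blast
  then obtain y xs where y: "zs = y # xs" by (cases zs) auto
  with zs have xs: "distinct (y # xs)" "length xs = length ts" by auto
  note i = repl_less[OF f]
  \<comment> \<open>The variables \<open>xs\<close> of the clause stand for the old arguments and
    \<open>y\<close> for the new one. All other variables may go to any well-formed term.\<close>
  define \<sigma> where "\<sigma> z = (if z = y then t else
    case map_of (zip xs ts) z of Some u \<Rightarrow> u | None \<Rightarrow> Var z)" for z
  have \<sigma>: "\<sigma> \<in> substs \<R>"
    using ded_bin_terms[OF d] f(1)
    by (auto simp: substs_def \<sigma>_def Fun_in_terms_iff split: option.split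
        dest!: map_of_SomeD set_zip_rightD intro: terms.intros)
  have nth: "\<sigma> (xs ! j) = ts ! j" if "j < length ts" for j
    using that xs by (auto simp: \<sigma>_def map_of_zip_nth)
  have m: "map \<sigma> xs = ts" using xs nth by (auto intro: nth_equalityI)
  have "prop_ax \<R> P \<subseteq> Th_CR \<R>"
    using P by (auto simp: Th_CR_def eq_ax_def rew_ax_def ps_ax_def)
  moreover have "(bin P (Fun f (map Var xs)) (Fun f (map Var (xs[i := y]))),
      [bin P (Var (xs ! i)) (Var y)]) \<in> prop_ax \<R> P"
    using f xs unfolding prop_ax_def Fun_in_terms_iff by fastforce
  ultimately have "(bin P (Fun f (map Var xs)) (Fun f (map Var (xs[i := y]))),
      [bin P (Var (xs ! i)) (Var y)]) \<in> Th_CR \<R>" by blast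
  then show ?thesis
    by (rule ded_intro[OF _ \<sigma>])
      (use d m nth i in \<open>auto simp: asubst_bin comp_def map_update \<sigma>_def[of y]\<close>)
qed

lemma equal_refl: assumes "s \<in> terms \<R>" shows "equal s s"
proof -
  fix x :: 'v
  have "(bin Eq (Var x) (Var x), []) \<in> Th_CR \<R>" by (auto simp: Th_CR_def eq_ax_def refl_ax_def)
  then show ?thesis
    by (rule ded_intro[where \<sigma> = "Var(x := s)"])
      (use assms in \<open>auto simp: substs_def asubst_bin intro: terms.intros\<close>)
qed

lemma equal_sym: assumes "equal s t" shows "equal t s"
proof -
  obtain x y :: 'v where xy: "x \<noteq> y"
    by (metis ex_new_if_finite finite.emptyI finite.insertI infinite_UNIV insertI1)
  then have "(bin Eq (Var y) (Var x), [bin Eq (Var x) (Var y)]) \<in> Th_CR \<R>"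
    by (auto simp: Th_CR_def eq_ax_def sym_ax_def)
  then show ?thesis
    by (rule ded_intro[where \<sigma> = "Var(x := s, y := t)"])
      (use assms ded_bin_terms[OF assms] xy in
        \<open>auto simp: substs_def asubst_bin intro: terms.intros\<close>)
qed

lemma equal_trans: assumes "equal s t" "equal t u" shows "equal s u"
proof -
  obtain x y z :: 'v where d: "distinct [x, y, z]"
    using ex_distinct_avoiding[of "{} :: 'v set" 3]
    by (fastforce simp: numeral_3_eq_3 length_Suc_conv)
  then have "(bin Eq (Var x) (Var z), [bin Eq (Var x) (Var y), bin Eq (Var y) (Var z)]) \<in> Th_CR \<R>"
    unfolding Th_CR_def eq_ax_def trans_ax_def by blast
  then show ?thesis
    by (rule ded_intro[where \<sigma> = "Var(x := s, y := t, z := u)"])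
      (use assms assms[THEN ded_bin_terms] d in
        \<open>auto simp: substs_def asubst_bin intro: terms.intros\<close>)
qed

lemma equal_arg:
  "Fun f ts \<in> terms \<R> \<Longrightarrow> i \<in> repl \<R> f \<Longrightarrow> equal (ts ! i) t \<Longrightarrow> equal (Fun f ts) (Fun f (ts[i := t]))"
  by (simp add: ded_prop)

section \<open>Deducible steps as closures of rule instances\<close>

text \<open>Conditions are evaluated in \<open>Th_CR\<close> even when \<open>rs\<close> consists of
  equations. Unlike \<open>step_E\<close>, the resulting steps cover conditional equations and
  generate all of \<open>equal\<close>.\<close>

definition rule_inst ::
  "('p, 'f, 'v) crule set \<Rightarrow> ('f, 'v) trm \<Rightarrow> ('f, 'v) trm \<Rightarrow> bool" where
  "rule_inst rs s t \<longleftrightarrow> (\<exists>l r c \<sigma>. (l, r, c) \<in> rs \<and> \<sigma> \<in> substs \<R> \<and>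
     (\<forall>A \<in> set c. ded (asubst \<sigma> A)) \<and> s = subst \<sigma> l \<and> t = subst \<sigma> r)"

lemma rule_instI:
  "(l, r, c) \<in> rs \<Longrightarrow> \<sigma> \<in> substs \<R> \<Longrightarrow> (\<And>A. A \<in> set c \<Longrightarrow> ded (asubst \<sigma> A))
    \<Longrightarrow> rule_inst rs (subst \<sigma> l) (subst \<sigma> r)"
  unfolding rule_inst_def by blast

definition mod_inst :: "('f, 'v) trm \<Rightarrow> ('f, 'v) trm \<Rightarrow> bool" where
  "mod_inst s t \<longleftrightarrow> (\<exists>l. equal s l \<and> rule_inst (Rls_rm \<R>) l t)"

abbreviation "E_step \<equiv> act_closure \<R> (rule_inst (sym_rules \<R>))"

lemma rule_inst_terms:
  "rule_inst (sym_rules \<R>) s t \<or> rule_inst (Rls_rm \<R>) s t \<Longrightarrow> s \<in> terms \<R> \<and> t \<in> terms \<R>"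
  by (auto simp: rule_inst_def dest: Rls_rm_wf sym_rules_wf intro: subst_in_terms)

lemma prop_ax_inst:
  assumes "(A, c) \<in> prop_ax \<R> P" "\<sigma> \<in> substs \<R>"
  shows "\<exists>f ts i t. asubst \<sigma> A = bin P (Fun f ts) (Fun f (ts[i := t])) \<and> Fun f ts \<in> terms \<R> \<and>
    i \<in> repl \<R> f \<and> map (asubst \<sigma>) c = [bin P (ts ! i) t]"
proof -
  from assms(1) obtain f i xs y where
    *: "A = bin P (Fun f (map Var xs)) (Fun f (map Var (xs[i := y])))"
      "c = [bin P (Var (xs ! i)) (Var y)]" "f \<in> Fsig \<R>" "i \<in> repl \<R> f" "length xs = far \<R> f"
    by (auto simp: prop_ax_def)
  have t: "Fun f (map \<sigma> xs) \<in> terms \<R>"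
    using * assms(2) by (auto simp: Fun_in_terms_iff substs_def)
  then have "i < length xs" using repl_less *(4) by fastforce
  with * t show ?thesis
    by (intro exI[of _ f] exI[of _ "map \<sigma> xs"] exI[of _ i] exI[of _ "\<sigma> y"])
      (auto simp: asubst_bin comp_def map_update)
qed

text \<open>An atom with predicate \<open>Rew\<close> can only be concluded by a propagation clause,
  which matches \<open>act_closure.arg\<close>, or by a rule clause, which matches
  \<open>act_closure.root\<close>.\<close>

lemma step_R_iff: "step_R \<R> s t \<longleftrightarrow> act_closure \<R> (rule_inst (Rls_rm \<R>)) s t"
proof
  have "ded A \<Longrightarrow> A = bin Rew s t \<Longrightarrow> act_closure \<R> (rule_inst (Rls_rm \<R>)) s t" for A s t
  proof (induction arbitrary: s t rule: deducible.induct)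
    case (1 A c \<sigma>)
    then have "apred A = Rew" by (simp add: asubst_def)
    with 1(1) consider "(A, c) \<in> prop_ax \<R> Rew" | "(A, c) \<in> rule_ax Rew (Rls_rm \<R>)"
      using Th_CR_Rew_head by blast
    then show ?case
    proof cases
      case a: 1
      from prop_ax_inst[OF a 1(2)] 1(3,4) show ?thesis
        by (fastforce intro: act_closure.arg)
    next
      case 2
      then show ?thesis using 1(2,3,4)
        by (auto simp: rule_ax_def asubst_bin intro!: act_closure.root rule_instI)
    qed
  qed
  then show "step_R \<R> s t \<Longrightarrow> act_closure \<R> (rule_inst (Rls_rm \<R>)) s t" by (simp add: step_R_def)
next
  show "act_closure \<R> (rule_inst (Rls_rm \<R>)) s t \<Longrightarrow> step_R \<R> s t"
  proof (induction rule: act_closure.induct)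
    case (root s t)
    then obtain l r c \<sigma> where *: "(l, r, c) \<in> Rls_rm \<R>" "\<sigma> \<in> substs \<R>"
      "\<forall>A \<in> set c. ded (asubst \<sigma> A)" "s = subst \<sigma> l" "t = subst \<sigma> r"
      by (auto simp: rule_inst_def)
    then have "(bin Rew l r, c) \<in> Th_CR \<R>" by (auto simp: Th_CR_def rew_ax_def rule_ax_def)
    then show ?case using * unfolding step_R_def by (auto intro: ded_intro simp: asubst_bin)
  next
    case (arg f ts i t)
    then show ?case by (simp add: step_R_def ded_prop)
  qed
qed

lemma step_RE_iff: "step_RE \<R> s t \<longleftrightarrow> act_closure \<R> mod_inst s t"
proof
  have "ded A \<Longrightarrow> A = bin RewPs s t \<Longrightarrow> act_closure \<R> mod_inst s t" for A s t
  proof (induction arbitrary: s t rule: deducible.induct)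
    case (1 A c \<sigma>)
    then have "apred A = RewPs" by (simp add: asubst_def)
    with 1(1) consider "(A, c) \<in> prop_ax \<R> RewPs" | "(A, c) \<in> modulo_rule_ax RewPs (Rls_rm \<R>)"
      using Th_CR_RewPs_head by blast
    then show ?case
    proof cases
      case a: 1
      from prop_ax_inst[OF a 1(2)] 1(3,4) show ?thesis
        by (fastforce intro: act_closure.arg)
    next
      case 2
      then show ?thesis using 1(2,3,4)
        by (fastforce simp: modulo_rule_ax_def asubst_bin mod_inst_def
            intro: act_closure.root rule_instI)
    qed
  qed
  then show "step_RE \<R> s t \<Longrightarrow> act_closure \<R> mod_inst s t" by (simp add: step_RE_def)
next
  show "act_closure \<R> mod_inst s t \<Longrightarrow> step_RE \<R> s t"
  proof (induction rule: act_closure.induct)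
    case (root s t)
    then obtain l r c \<sigma> where *: "(l, r, c) \<in> Rls_rm \<R>" "\<sigma> \<in> substs \<R>"
      "\<forall>A \<in> set c. ded (asubst \<sigma> A)" "equal s (subst \<sigma> l)" "t = subst \<sigma> r"
      by (auto simp: rule_inst_def mod_inst_def)
    obtain x where x: "x \<notin> rule_vars (l, r, c)"
      using ex_new_if_finite[OF infinite_UNIV finite_rule_vars] by blast
    \<comment> \<open>The fresh variable of the clause is bound to the redex \<open>s\<close>. Since
      it does not occur in the rule, both sides and the conditions keep their instances.\<close>
    let ?\<sigma> = "\<sigma>(x := s)"
    have sub: "subst ?\<sigma> l = subst \<sigma> l" "subst ?\<sigma> r = subst \<sigma> r"
      "\<And>A. A \<in> set c \<Longrightarrow> asubst ?\<sigma> A = asubst \<sigma> A"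
      using x by (auto intro!: subst_cong asubst_cong)
    have "(bin RewPs (Var x) r, bin Eq (Var x) l # c) \<in> Th_CR \<R>"
      using *(1) x by (auto simp: Th_CR_def ps_ax_def modulo_rule_ax_def)
    then show ?case unfolding step_RE_def
      by (rule ded_intro[where \<sigma> = ?\<sigma>])
        (use * sub ded_bin_terms[OF *(4)] in \<open>auto simp: asubst_bin substs_def\<close>)
  next
    case (arg f ts i t)
    then show ?case by (simp add: step_RE_def ded_prop)
  qed
qed

lemma step_RmodE_iff:
  "step_RmodE \<R> s t \<longleftrightarrow> (\<exists>s' t'. equal s s' \<and> step_R \<R> s' t' \<and> equal t' t)"
proof
  assume "step_RmodE \<R> s t"
  then have "ded (bin RewRm s t)" by (simp add: step_RmodE_def)
  then show "\<exists>s' t'. equal s s' \<and> step_R \<R> s' t' \<and> equal t' t"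
  proof (cases rule: deducible.cases)
    case (1 A c \<sigma>)
    then have "apred A = RewRm" by (metis asubst_def atom.sel(1))
    from Th_CR_RewRm_head[OF 1(2) this] 1 show ?thesis
      by (fastforce simp: asubst_bin step_R_def)
  qed
next
  assume "\<exists>s' t'. equal s s' \<and> step_R \<R> s' t' \<and> equal t' t"
  then obtain s' t' where *: "equal s s'" "ded (bin Rew s' t')" "equal t' t"
    by (auto simp: step_R_def)
  obtain x x' y' y :: 'v where d: "distinct [x, x', y', y]"
    using ex_distinct_avoiding[of "{} :: 'v set" 4]
    by (fastforce simp: eval_nat_numeral length_Suc_conv)
  then have "(bin RewRm (Var x) (Var y),
     [bin Eq (Var x) (Var x'), bin Rew (Var x') (Var y'), bin Eq (Var y') (Var y)]) \<in> Th_CR \<R>"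
    unfolding Th_CR_def rm_ax_def by blast
  then show "step_RmodE \<R> s t" unfolding step_RmodE_def
    by (rule ded_intro[where \<sigma> = "Var(x := s, x' := s', y' := t', y := t)"])
      (use * *[THEN ded_bin_terms] d in \<open>auto simp: substs_def asubst_bin intro: terms.intros\<close>)
qed

lemma step_RE_terms: "step_RE \<R> s t \<Longrightarrow> s \<in> terms \<R> \<and> t \<in> terms \<R>"
  by (simp add: step_RE_def ded_bin_terms)

lemma step_R_imp_step_RE: "step_R \<R> s t \<Longrightarrow> step_RE \<R> s t"
  unfolding step_R_iff step_RE_iff
  by (erule act_closure_mono) (metis equal_refl mod_inst_def rule_inst_terms)

lemma step_RE_arg:
  "Fun f ts \<in> terms \<R> \<Longrightarrow> i \<in> repl \<R> f \<Longrightarrow> step_RE \<R> (ts ! i) t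
    \<Longrightarrow> step_RE \<R> (Fun f ts) (Fun f (ts[i := t]))"
  by (simp add: step_RE_def ded_prop)

lemma update_in_terms:
  "Fun f ts \<in> terms \<R> \<Longrightarrow> t \<in> terms \<R> \<Longrightarrow> Fun f (ts[i := t]) \<in> terms \<R>"
  by (auto simp: Fun_in_terms_iff dest!: set_update_subset_insert[THEN subsetD])

text \<open>The equality applied at the redex can be pulled out of the active context, because
  \<open>equal\<close> is propagated through active arguments too.\<close>

lemma step_RE_equal_step_R: "step_RE \<R> s t \<Longrightarrow> \<exists>s'. equal s s' \<and> step_R \<R> s' t"
  unfolding step_RE_iff
proof (induction rule: act_closure.induct)
  case (root s t)
  then show ?case by (auto simp: mod_inst_def step_R_iff intro: act_closure.root)
next
  case (arg f ts i t)
  then obtain s' where s': "equal (ts ! i) s'" "step_R \<R> s' t" by blast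
  have "step_R \<R> (Fun f (ts[i := s'])) (Fun f (ts[i := s', i := t]))"
    unfolding step_R_def
    by (rule ded_prop) (use s' arg repl_less[OF arg(1,2)] in
      \<open>auto simp: step_R_def dest: ded_bin_terms intro: update_in_terms\<close>)
  then show ?case using equal_arg[OF arg(1,2) s'(1)] by auto
qed

lemma equal_step_RE_imp_RmodE: "equal s s' \<Longrightarrow> step_RE \<R> s' t \<Longrightarrow> step_RmodE \<R> s t"
  unfolding step_RmodE_iff
  by (metis equal_refl equal_trans step_RE_equal_step_R step_RE_terms)

lemma step_RmodE_imp_RE:
  "step_RmodE \<R> s t \<Longrightarrow> \<exists>s' t'. equal s s' \<and> step_RE \<R> s' t' \<and> equal t' t"
  unfolding step_RmodE_iff by (blast intro: step_R_imp_step_RE)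

text \<open>No clause propagates \<open>RewRm\<close>. The step is split into equality, step and
  equality, each of which is propagated separately.\<close>

lemma step_RmodE_arg:
  assumes f: "Fun f ts \<in> terms \<R>" "i \<in> repl \<R> f" and st: "step_RmodE \<R> (ts ! i) t"
  shows "step_RmodE \<R> (Fun f ts) (Fun f (ts[i := t]))"
proof -
  obtain s' t' where *: "equal (ts ! i) s'" "step_RE \<R> s' t'" "equal t' t"
    using step_RmodE_imp_RE[OF st] by blast
  note i = repl_less[OF f]
  have 1: "equal (Fun f ts) (Fun f (ts[i := s']))" using equal_arg f *(1) by blast
  have T: "Fun f (ts[i := s']) \<in> terms \<R>" "Fun f (ts[i := t']) \<in> terms \<R>"
    using f(1) step_RE_terms[OF *(2)] by (simp_all add: update_in_terms)
  have 2: "step_RE \<R> (Fun f (ts[i := s'])) (Fun f (ts[i := t']))"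
    using step_RE_arg[OF T(1) f(2), of t'] i *(2) by simp
  have 3: "equal (Fun f (ts[i := t'])) (Fun f (ts[i := t]))"
    using equal_arg[OF T(2) f(2), of t] i *(3) by simp
  show ?thesis using 1 2 3 equal_trans step_RE_equal_step_R step_RmodE_iff by blast
qed

section \<open>Equality as a chain of equational steps\<close>

lemma E_step_equal: "E_step s t \<Longrightarrow> equal s t"
proof (induction rule: act_closure.induct)
  case (root s t)
  then obtain l r c \<sigma> where *: "(l, r, c) \<in> sym_rules \<R>" "\<sigma> \<in> substs \<R>"
    "\<forall>A \<in> set c. ded (asubst \<sigma> A)" "s = subst \<sigma> l" "t = subst \<sigma> r"
    by (auto simp: rule_inst_def)
  \<comment> \<open>This treats the orientation found in \<open>Eqs\<close>. The reversed members of
    \<open>sym_rules\<close> follow by symmetry.\<close>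
  have "equal (subst \<sigma> l') (subst \<sigma> r')" if "(l', r', c) \<in> Eqs \<R>" for l' r'
  proof -
    have "(bin Eq l' r', c) \<in> Th_CR \<R>"
      using that by (auto simp: Th_CR_def eq_ax_def rule_ax_def)
    then show ?thesis using * by (auto intro: ded_intro simp: asubst_bin)
  qed
  then show ?case using * by (auto simp: sym_rules_def intro: equal_sym)
qed (simp add: equal_arg)

lemma E_step_sym: "E_step s t \<Longrightarrow> E_step t s"
proof (induction rule: act_closure.induct)
  case (root s t)
  then have "rule_inst (sym_rules \<R>) t s"
    unfolding rule_inst_def sym_rules_def by blast
  then show ?case by (rule act_closure.root)
next
  case (arg f ts i t)
  have i: "i < length ts" using arg repl_less by blast
  have "t \<in> terms \<R>" using E_step_equal[OF arg(3)] ded_bin_terms by blast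
  then have "Fun f (ts[i := t]) \<in> terms \<R>" using arg(1) update_in_terms by blast
  from act_closure.arg[OF this arg(2), of _ "ts ! i"] arg(4) i show ?case by simp
qed

lemma E_steps_arg:
  assumes "E_step\<^sup>*\<^sup>* s t" "Fun f ts \<in> terms \<R>" "i \<in> repl \<R> f" "s = ts ! i"
  shows "E_step\<^sup>*\<^sup>* (Fun f ts) (Fun f (ts[i := t]))"
  using assms(1)
proof (induction rule: rtranclp_induct)
  case (step u v)
  have i: "i < length ts" using assms repl_less by blast
  have "u \<in> terms \<R>" using E_step_equal[OF step(2)] ded_bin_terms by blast
  then have "Fun f (ts[i := u]) \<in> terms \<R>" using assms(2) update_in_terms by blast
  from act_closure.arg[OF this assms(3), of _ v] step(2) i
  have "E_step (Fun f (ts[i := u])) (Fun f (ts[i := v]))" by simp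
  with step(3) show ?case by (rule rtranclp.rtrancl_into_rtrancl)
qed (simp add: assms(4))

text \<open>Symmetry of a deduction is matched by reversing the chain, as \<open>sym_rules\<close>
  contains both orientations. The chain makes induction on single equational steps possible.\<close>

lemma equal_imp_E_steps: "equal s t \<Longrightarrow> E_step\<^sup>*\<^sup>* s t"
proof -
  have "ded A \<Longrightarrow> A = bin Eq s t \<Longrightarrow> E_step\<^sup>*\<^sup>* s t" for A s t
  proof (induction arbitrary: s t rule: deducible.induct)
    case (1 A c \<sigma>)
    then have "apred A = Eq" by (simp add: asubst_def)
    with 1(1) have "(A, c) \<in> eq_ax \<R>" using Th_CR_Eq_head by blast
    then consider "(A, c) \<in> refl_ax Eq" | "(A, c) \<in> sym_ax Eq" | "(A, c) \<in> trans_ax Eq Eq"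
      | "(A, c) \<in> prop_ax \<R> Eq" | "(A, c) \<in> rule_ax Eq (Eqs \<R>)"
      by (auto simp: eq_ax_def)
    then show ?case
    proof cases
      case 2
      then have "E_step\<^sup>*\<^sup>* t s" using 1(3,4) by (auto simp: sym_ax_def asubst_bin)
      moreover have "symp E_step" using E_step_sym by (auto intro: sympI)
      ultimately show ?thesis by (meson symp_rtranclp sympD)
    next
      case a: 4
      from prop_ax_inst[OF a 1(2)] 1(3,4) show ?thesis by (fastforce intro: E_steps_arg)
    next
      case 5
      then show ?thesis using 1(2,3,4)
        by (auto simp: rule_ax_def asubst_bin
            intro!: r_into_rtranclp[of E_step] act_closure.root rule_instI)
          (auto simp: sym_rules_def)
    qed (use 1(3,4) in \<open>auto simp: refl_ax_def trans_ax_def asubst_bin\<close>)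
  qed
  then show "equal s t \<Longrightarrow> E_step\<^sup>*\<^sup>* s t" by blast
qed

lemma step_E_equal: assumes "step_E \<R> s t" shows "equal s t"
proof -
  let ?Th = "rew_ax \<R> (sym_rules \<R>)"
  have head: "deducible \<R> ?Th A \<Longrightarrow> apred A \<in> {Rew, Rews}" for A
    by (erule deducible.cases) (auto simp: rew_ax_def asubst_def dest: head_preds)
  have "deducible \<R> ?Th A \<Longrightarrow> A = bin Rew s t \<Longrightarrow> equal s t" for A s t
  proof (induction arbitrary: s t rule: deducible.induct)
    case (1 A c \<sigma>)
    then have "apred A = Rew" by (simp add: asubst_def)
    with 1(1) consider "(A, c) \<in> prop_ax \<R> Rew" | "(A, c) \<in> rule_ax Rew (sym_rules \<R>)"
      by (auto simp: rew_ax_def dest: head_preds)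
    then show ?case
    proof cases
      case a: 1
      from prop_ax_inst[OF a 1(2)] 1(3,4) show ?thesis by (fastforce intro: equal_arg)
    next
      case 2
      then obtain l r where lr: "A = bin Rew l r" "(l, r, c) \<in> sym_rules \<R>"
        by (auto simp: rule_ax_def)
      \<comment> \<open>Equality does not depend on the rules and the theory of \<open>step_E\<close> only has clauses for
        rewriting atoms, so only unconditional equations can be applied.\<close>
      have "c = []"
      proof (rule ccontr)
        assume "c \<noteq> []"
        then obtain B where B: "B \<in> set c" by (cases c) auto
        then have "apred B \<in> {Rew, Rews}" using 1(3) head[of "asubst \<sigma> B"] by (auto simp: asubst_def)
        then have "depends_on_R \<R> (apred B)" by (auto intro: depends_on_R.intros)
        then have "depends_on_R \<R> Eq"
          using lr(2) B by (auto simp: sym_rules_def intro: depends_on_R.intros)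
        then show False using wf by (simp add: is_egtrs_def)
      qed
      with lr 1(2) have "rule_inst (sym_rules \<R>) (subst \<sigma> l) (subst \<sigma> r)"
        by (auto intro: rule_instI)
      then show ?thesis using lr 1(4) by (auto simp: asubst_bin intro: E_step_equal act_closure.root)
    qed
  qed
  then show ?thesis using assms by (simp add: step_E_def)
qed

section \<open>Joinability\<close>

lemma RE_joinable_iff:
  "RE_joinable \<R> s t \<longleftrightarrow> (\<exists>u u'. (step_RE \<R>)\<^sup>*\<^sup>* s u \<and> (step_RE \<R>)\<^sup>*\<^sup>* t u' \<and> equal u u')"
  by (simp add: RE_joinable_def eq_E_iff)

lemma RE_joinable_sym: "RE_joinable \<R> s t \<Longrightarrow> RE_joinable \<R> t s"
  unfolding RE_joinable_iff by (blast intro: equal_sym)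

lemma RE_joinable_refl: "s \<in> terms \<R> \<Longrightarrow> RE_joinable \<R> s s"
  unfolding RE_joinable_iff by (blast intro: equal_refl)

lemma RE_joinable_equal: "equal s t \<Longrightarrow> RE_joinable \<R> s t"
  unfolding RE_joinable_iff by blast

lemma RE_joinable_steps:
  "(step_RE \<R>)\<^sup>*\<^sup>* s s' \<Longrightarrow> (step_RE \<R>)\<^sup>*\<^sup>* t t' \<Longrightarrow> RE_joinable \<R> s' t' \<Longrightarrow> RE_joinable \<R> s t"
  unfolding RE_joinable_iff by (meson rtranclp_trans)

lemma steps_RE_arg:
  assumes "(step_RE \<R>)\<^sup>*\<^sup>* s t" "Fun f ts \<in> terms \<R>" "i \<in> repl \<R> f"
  shows "(step_RE \<R>)\<^sup>*\<^sup>* (Fun f (ts[i := s])) (Fun f (ts[i := t]))"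
  using assms(1)
proof (induction rule: rtranclp_induct)
  case (step u v)
  have i: "i < length ts" using assms repl_less by blast
  have "Fun f (ts[i := u]) \<in> terms \<R>"
    using assms(2) step_RE_terms[OF step(2)] update_in_terms by blast
  from step_RE_arg[OF this assms(3), of v] step(2) i
  have "step_RE \<R> (Fun f (ts[i := u])) (Fun f (ts[i := v]))" by simp
  with step(3) show ?case by (rule rtranclp.rtrancl_into_rtrancl)
qed simp

text \<open>Both sides are updates of one argument list, which is the shape of a peak whose two
  steps lie in the same argument.\<close>

lemma RE_joinable_arg:
  assumes "RE_joinable \<R> s t" and f: "Fun f ts \<in> terms \<R>" "i \<in> repl \<R> f"
  shows "RE_joinable \<R> (Fun f (ts[i := s])) (Fun f (ts[i := t]))"
proof -
  obtain u u' where u: "(step_RE \<R>)\<^sup>*\<^sup>* s u" "(step_RE \<R>)\<^sup>*\<^sup>* t u'" "equal u u'"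
    using assms(1) RE_joinable_iff by blast
  have "Fun f (ts[i := u]) \<in> terms \<R>"
    using f(1) ded_bin_terms[OF u(3)] update_in_terms by blast
  from equal_arg[OF this f(2), of u'] u(3) repl_less[OF f]
  have "equal (Fun f (ts[i := u])) (Fun f (ts[i := u']))" by simp
  then show ?thesis using u(1,2)[THEN steps_RE_arg[OF _ f]] RE_joinable_iff by blast
qed

section \<open>Critical peaks\<close>

text \<open>Following the step from the root of \<open>l\<close> downwards, one either meets the
  redex at a function symbol of \<open>l\<close> or reaches a variable \<open>x\<close> of
  \<open>l\<close>. In the latter case what remains is a step of arbitrary depth from
  \<open>\<sigma> x\<close>.\<close>

lemma peak_position:
  assumes "step_RE \<R> (subst \<sigma> l) e"
  shows "(\<exists>p v. p \<in> active_fun_pos (repl \<R>) l \<and> mod_inst (subst \<sigma> (subt_at l p)) v \<and>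
      e = replace_at (subst \<sigma> l) p v) \<or>
    (\<exists>x p v. p \<in> active_var_pos (repl \<R>) x l \<and> step_RE \<R> (\<sigma> x) v \<and>
      e = replace_at (subst \<sigma> l) p v)"
  using assms
proof (induction l arbitrary: e)
  case (Var x)
  then show ?case by (auto simp: active_var_pos_def)
next
  case (Fun f ls)
  from Fun.prems have "act_closure \<R> mod_inst (Fun f (map (subst \<sigma>) ls)) e"
    by (simp add: step_RE_iff)
  then show ?case
  proof (cases rule: act_closure.cases)
    case root
    then show ?thesis by (auto simp: active_fun_pos_def intro!: exI[of _ "[]"])
  next
    case (arg i t)
    have i: "i < length ls" using repl_less[OF arg(2,3)] by simp
    then have "step_RE \<R> (subst \<sigma> (ls ! i)) t" using arg(4) by (simp add: step_RE_iff)
    from Fun.IH[OF nth_mem[OF i] this] consider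
      (fn) p v where "p \<in> active_fun_pos (repl \<R>) (ls ! i)" "mod_inst (subst \<sigma> (subt_at (ls ! i) p)) v"
        "t = replace_at (subst \<sigma> (ls ! i)) p v"
      | (var) x p v where "p \<in> active_var_pos (repl \<R>) x (ls ! i)" "step_RE \<R> (\<sigma> x) v"
        "t = replace_at (subst \<sigma> (ls ! i)) p v"
      by blast
    then show ?thesis
    proof cases
      case fn
      then show ?thesis using i arg
        by (intro disjI1 exI[of _ "i # p"] exI[of _ v]) (auto simp: active_fun_pos_def)
    next
      case var
      then show ?thesis using i arg
        by (intro disjI2 exI[of _ x] exI[of _ "i # p"] exI[of _ v]) (auto simp: active_var_pos_def)
    qed
  qed
qed

text \<open>A redex at a function position instantiates an LCCP, one at or below a variable position
  instantiates a CVP. An LCCP carries an equality as condition instead of a unifier, and that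
  equality is what \<open>mod_inst\<close> provides. The set \<open>rs\<close> may consist of rules
  or of equations.\<close>

lemma critical_peak:
  assumes joinable: "\<forall>\<alpha> \<in> lccps \<R> rs (Rls_rm \<R>) \<union> cvps_ps \<R> rs. pair_joinable \<R> \<alpha>"
    and rule: "(l, r, c) \<in> rs" and \<sigma>: "\<sigma> \<in> substs \<R>" "\<forall>A \<in> set c. ded (asubst \<sigma> A)"
    and step: "step_RE \<R> (subst \<sigma> l) e"
  shows "RE_joinable \<R> e (subst \<sigma> r)"
  using peak_position[OF step]
proof (elim disjE exE conjE)
  fix p v
  assume p: "p \<in> active_fun_pos (repl \<R>) l" and mi: "mod_inst (subst \<sigma> (subt_at l p)) v"
    and e: "e = replace_at (subst \<sigma> l) p v"
  from mi obtain l' r' c' \<tau> where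
    rule': "(l', r', c') \<in> Rls_rm \<R>" and \<tau>: "\<tau> \<in> substs \<R>" "\<forall>A \<in> set c'. ded (asubst \<tau> A)"
    and eq: "equal (subst \<sigma> (subt_at l p)) (subst \<tau> l')" and v: "v = subst \<tau> r'"
    by (auto simp: mod_inst_def rule_inst_def)
  obtain \<pi> :: "'v \<Rightarrow> 'v" where \<pi>: "bij \<pi>"
    and disj: "\<pi> ` rule_vars (l', r', c') \<inter> rule_vars (l, r, c) = {}"
    using ex_bij_avoiding[OF finite_rule_vars finite_rule_vars] by blast
  define ren where "ren = subst (Var \<circ> \<pi> :: 'v \<Rightarrow> ('f, 'v) trm)"
  define aren where "aren = (asubst (Var \<circ> \<pi>) :: ('p, 'f, 'v) atom \<Rightarrow> _)"
  have rs': "rule_subst (Var \<circ> \<pi>) (l', r', c') = (ren l', ren r', map aren c')"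
    by (simp add: ren_def aren_def)
  have var: "(ren l', ren r', map aren c') \<in> variants (Rls_rm \<R>)"
    unfolding variants_def rs'[symmetric] using \<pi> rule' by blast
  have disj': "rule_vars (l, r, c) \<inter> rule_vars (ren l', ren r', map aren c') = {}"
    using disj unfolding rs'[symmetric] rule_vars_subst_Var by blast
  have "(replace_at l p (ren r'), r, bin Eq (subt_at l p) (ren l') # c @ map aren c')
      \<in> lccps \<R> rs (Rls_rm \<R>)"
    unfolding lccps_def using rule var disj' p by blast
  then have pj: "pair_joinable \<R>
      (replace_at l p (ren r'), r, bin Eq (subt_at l p) (ren l') # c @ map aren c')"
    using joinable by blast
  \<comment> \<open>Gluing the two matchers: \<open>\<sigma>\<close> on the outer rule and, through
    the inverse renaming, \<open>\<tau>\<close> on the renamed inner rule. Disjointness of the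
    variables makes this consistent.\<close>
  define \<rho> where "\<rho> x = (if x \<in> rule_vars (l, r, c) then \<sigma> x else \<tau> (inv \<pi> x))" for x
  have \<rho>: "\<rho> \<in> substs \<R>" using \<sigma>(1) \<tau>(1) by (auto simp: substs_def \<rho>_def)
  have \<rho>\<pi>: "\<rho> (\<pi> x) = \<tau> x" if "x \<in> rule_vars (l', r', c')" for x
    using that disj \<pi> by (auto simp: \<rho>_def bij_is_inj inv_f_f simp del: rule_vars.simps)
  have ren: "subst \<rho> (ren l') = subst \<tau> l'" "subst \<rho> (ren r') = subst \<tau> r'"
    "\<And>A. A \<in> set c' \<Longrightarrow> asubst \<rho> (aren A) = asubst \<tau> A"
    unfolding ren_def aren_def subst_subst asubst_asubst
    by (auto intro!: subst_cong asubst_cong \<rho>\<pi>)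
  have act: "p \<in> active_pos (repl \<R>) l" using p by (simp add: active_fun_pos_def)
  have old: "subst \<rho> l = subst \<sigma> l" "subst \<rho> r = subst \<sigma> r"
    "subst \<rho> (subt_at l p) = subst \<sigma> (subt_at l p)" "\<And>A. A \<in> set c \<Longrightarrow> asubst \<rho> A = asubst \<sigma> A"
    using tvars_subt_at[OF act] by (auto simp: \<rho>_def intro!: subst_cong asubst_cong)
  have "RE_joinable \<R> (subst \<rho> (replace_at l p (ren r'))) (subst \<rho> r)"
    using pj \<rho> eq \<sigma>(2) \<tau>(2) by (auto simp: asubst_bin ren old)
  then show ?thesis by (simp add: subst_replace_at[OF act] old ren e v)
next
  fix x p v
  assume p: "p \<in> active_var_pos (repl \<R>) x l" and st: "step_RE \<R> (\<sigma> x) v"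
    and e: "e = replace_at (subst \<sigma> l) p v"
  obtain x' where x': "x' \<notin> rule_vars (l, r, c)"
    using ex_new_if_finite[OF infinite_UNIV finite_rule_vars] by blast
  have act: "p \<in> active_pos (repl \<R>) l" and "subt_at l p = Var x"
    using p by (simp_all add: active_var_pos_def)
  then have "x \<in> tvars l" using tvars_subt_at[OF act] by simp
  then have ne: "x \<noteq> x'" using x' by auto
  have "(replace_at l p (Var x'), r, bin RewPs (Var x) (Var x') # c) \<in> cvps_ps \<R> rs"
    unfolding cvps_ps_def active_vars_def using rule p x' by blast
  then have pj: "pair_joinable \<R> (replace_at l p (Var x'), r, bin RewPs (Var x) (Var x') # c)"
    using joinable by blast
  \<comment> \<open>Under this instance the condition
    \<open>x \<rightarrow>\<^sub>p\<^sub>s x'\<close> of the CVP becomes the given step from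
    \<open>\<sigma> x\<close> to \<open>v\<close>.\<close>
  let ?\<rho> = "\<sigma>(x' := v)"
  have \<rho>: "?\<rho> \<in> substs \<R>" using \<sigma>(1) step_RE_terms[OF st] by (auto simp: substs_def)
  have old: "subst ?\<rho> l = subst \<sigma> l" "subst ?\<rho> r = subst \<sigma> r"
    "\<And>A. A \<in> set c \<Longrightarrow> asubst ?\<rho> A = asubst \<sigma> A"
    using x' by (auto intro!: subst_cong asubst_cong)
  have "RE_joinable \<R> (subst ?\<rho> (replace_at l p (Var x'))) (subst ?\<rho> r)"
    using pj \<rho> st \<sigma>(2) ne by (auto simp: asubst_bin old step_RE_def simp del: fun_upd_apply)
      (auto simp: asubst_bin old step_RE_def)
  then show ?thesis by (simp add: subst_replace_at[OF act] old e del: fun_upd_apply) simp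
qed

end

section \<open>Peaks of a rewrite step and an equational step\<close>

locale joinable_egtrs = wf_egtrs \<R> for \<R> :: "('p, 'f, 'v :: infinite) egtrs" +
  assumes terminating: "E_terminating \<R>"
    and joinable_R: "\<forall>\<alpha> \<in> lccps \<R> (Rls_rm \<R>) (Rls_rm \<R>) \<union> cvps_ps \<R> (Rls_rm \<R>). pair_joinable \<R> \<alpha>"
    and joinable_E: "\<forall>\<alpha> \<in> lccps \<R> (sym_rules \<R>) (Rls_rm \<R>) \<union> cvps_ps \<R> (sym_rules \<R>). pair_joinable \<R> \<alpha>"
begin

lemma wfp_RmodE: "wfp (step_RmodE \<R>)\<inverse>\<inverse>"
  using terminating unfolding E_terminating_def wfp_def wf_iff_no_infinite_down_chain by simp

lemma critical_peak_R:
  "rule_inst (Rls_rm \<R>) s t \<Longrightarrow> step_RE \<R> s e \<Longrightarrow> RE_joinable \<R> e t"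
  unfolding rule_inst_def using critical_peak[OF joinable_R] by blast

lemma critical_peak_E:
  "rule_inst (sym_rules \<R>) s t \<Longrightarrow> step_RE \<R> s e \<Longrightarrow> RE_joinable \<R> e t"
  unfolding rule_inst_def using critical_peak[OF joinable_E] by blast

text \<open>Induction on the position of the equational step. At the root the peak is critical.
  Below the root, the rewrite step is either at the root, in the same argument (induction
  hypothesis), or in another argument, where the two steps commute.\<close>

lemma E_step_peak: "E_step s t \<Longrightarrow> step_RE \<R> s e \<Longrightarrow> RE_joinable \<R> e t"
proof (induction arbitrary: e rule: act_closure.induct)
  case (root s t)
  then show ?case by (rule critical_peak_E)
next
  case (arg f ts j t)
  have t: "equal (ts ! j) t" using E_step_equal[OF arg(3)] .
  then have tT: "t \<in> terms \<R>" using ded_bin_terms by blast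
  have eq: "equal (Fun f ts) (Fun f (ts[j := t]))" using equal_arg[OF arg(1,2) t] .
  have j: "j < length ts" using repl_less[OF arg(1,2)] .
  from arg.prems have "act_closure \<R> mod_inst (Fun f ts) e" by (simp add: step_RE_iff)
  then show ?case
  proof (cases rule: act_closure.cases)
    case root
    \<comment> \<open>A root step modulo equality absorbs the equational step, so the other side
      rewrites to the same \<open>e\<close>.\<close>
    then have "mod_inst (Fun f (ts[j := t])) e"
      unfolding mod_inst_def using eq equal_sym equal_trans by blast
    then have "step_RE \<R> (Fun f (ts[j := t])) e" by (simp add: step_RE_iff act_closure.root)
    then show ?thesis
      using RE_joinable_steps[of e e] RE_joinable_refl step_RE_terms by blast
  next
    case a: (arg i t')
    then have st: "step_RE \<R> (ts ! i) t'" by (simp add: step_RE_iff)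
    show ?thesis
    proof (cases "i = j")
      case True
      then show ?thesis using arg.IH st a(1) RE_joinable_arg[OF _ arg(1,2)] by blast
    next
      case False
      have T: "Fun f (ts[j := t]) \<in> terms \<R>" "Fun f (ts[i := t']) \<in> terms \<R>"
        using arg(1) update_in_terms tT step_RE_terms[OF st] by blast+
      have "step_RE \<R> (Fun f (ts[j := t])) (Fun f (ts[j := t, i := t']))"
        using step_RE_arg[OF T(1) a(3), of t'] st False by simp
      moreover have "equal (Fun f (ts[i := t'])) (Fun f (ts[i := t', j := t]))"
        using equal_arg[OF T(2) arg(2), of t] t False by simp
      ultimately show ?thesis
        using RE_joinable_equal RE_joinable_steps False a(1)
        by (metis list_update_swap r_into_rtranclp rtranclp.rtrancl_refl)
    qed
  qed
qed

section \<open>Confluence at a term and the induction hypothesis\<close>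

abbreviation "rewrites_mod \<equiv> (sup (step_RE \<R>) equal)\<^sup>*\<^sup>*"

text \<open>Stronger than confluence of \<open>step_RE\<close>: equalities may be interleaved with
  the steps leaving \<open>w\<close>, while the join allows one only at its end. This is what lets
  joins be composed.\<close>

definition confluent_at :: "('f, 'v) trm \<Rightarrow> bool" where
  "confluent_at w \<longleftrightarrow> (w \<in> terms \<R> \<longrightarrow>
     (\<forall>a b. rewrites_mod w a \<longrightarrow> rewrites_mod w b \<longrightarrow> RE_joinable \<R> a b))"

text \<open>The induction hypothesis covers active subterms of reducts as well, so that it passes
  from a term to its active subterms.\<close>

definition confluent_below :: "('f, 'v) trm \<Rightarrow> bool" where
  "confluent_below s \<longleftrightarrow>
     (\<forall>d u. step_RmodE \<R> s d \<longrightarrow> act_subterm \<R> d u \<longrightarrow> confluent_at u)"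

lemma steps_RE_rewrites_mod: "(step_RE \<R>)\<^sup>*\<^sup>* s t \<Longrightarrow> rewrites_mod s t"
  by (erule rtranclp_mono[THEN predicate2D, rotated]) auto

lemma RE_joinable_rewrites_mod:
  assumes "RE_joinable \<R> s t"
  shows "\<exists>u. (step_RE \<R>)\<^sup>*\<^sup>* s u \<and> rewrites_mod t u"
proof -
  obtain u u' where u: "(step_RE \<R>)\<^sup>*\<^sup>* s u" "(step_RE \<R>)\<^sup>*\<^sup>* t u'" "equal u u'"
    using assms RE_joinable_iff by blast
  then have "rewrites_mod t u'" "sup (step_RE \<R>) equal u' u"
    by (auto intro: steps_RE_rewrites_mod equal_sym)
  then show ?thesis using u(1) by (meson rtranclp.rtrancl_into_rtrancl)
qed

text \<open>Once their closing equalities are reversed, the two joins yield terms \<open>x\<close>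
  and \<open>y\<close> that \<open>b\<close> reaches by \<open>rewrites_mod\<close>, and confluence
  at \<open>b\<close> joins these.\<close>

lemma RE_joinable_trans:
  assumes "RE_joinable \<R> a b" "RE_joinable \<R> b c" "confluent_at b" "b \<in> terms \<R>"
  shows "RE_joinable \<R> a c"
proof -
  obtain x where x: "(step_RE \<R>)\<^sup>*\<^sup>* a x" "rewrites_mod b x"
    using RE_joinable_rewrites_mod[OF assms(1)] by blast
  obtain y where y: "(step_RE \<R>)\<^sup>*\<^sup>* c y" "rewrites_mod b y"
    using RE_joinable_rewrites_mod[OF RE_joinable_sym[OF assms(2)]] by blast
  have "RE_joinable \<R> x y" using x(2) y(2) assms(3,4) by (simp add: confluent_at_def)
  then show ?thesis using x(1) y(1) RE_joinable_steps by blast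
qed

lemma confluent_below_step:
  "confluent_below s \<Longrightarrow> equal s s' \<Longrightarrow> step_RE \<R> s' d \<Longrightarrow> confluent_at d"
  unfolding confluent_below_def by (blast intro: equal_step_RE_imp_RmodE act_subterm.refl)

text \<open>A step modulo equality in an active argument lifts to the whole term, and the reduct of
  the argument is an active subterm of the lifted reduct.\<close>

lemma confluent_below_arg:
  assumes "confluent_below (Fun f ts)" "Fun f ts \<in> terms \<R>" "i \<in> repl \<R> f"
  shows "confluent_below (ts ! i)"
  unfolding confluent_below_def
proof (intro allI impI)
  fix d u assume d: "step_RmodE \<R> (ts ! i) d" "act_subterm \<R> d u"
  have "d \<in> terms \<R>" using d(1) by (auto simp: step_RmodE_def dest: ded_bin_terms)
  then have "Fun f (ts[i := d]) \<in> terms \<R>" using assms(2) update_in_terms by blast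
  then have "act_subterm \<R> (Fun f (ts[i := d])) u"
    by (rule act_subterm.arg[OF _ assms(3)]) (use d(2) repl_less[OF assms(2,3)] in simp)
  then show "confluent_at u"
    using assms(1) step_RmodE_arg[OF assms(2,3) d(1)] unfolding confluent_below_def by blast
qed

text \<open>Such a loop contains a genuine step, so it is a nonempty cycle of
  \<open>step_RmodE\<close>, against termination.\<close>

lemma equal_steps_RE_irrefl:
  assumes "equal s s'" "step_RE \<R> s' d" "rewrites_mod d s"
  shows False
proof -
  have "rewrites_mod d t \<Longrightarrow> (step_RmodE \<R>)\<^sup>+\<^sup>+ s t" for t
  proof (induction rule: rtranclp_induct)
    case base
    then show ?case using assms equal_step_RE_imp_RmodE by blast
  next
    case (step y z)
    from step(2) show ?case
    proof
      assume "step_RE \<R> y z"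
      then have "step_RmodE \<R> y z"
        using equal_step_RE_imp_RmodE equal_refl step_RE_terms by blast
      with step(3) show ?case by (rule tranclp.trancl_into_trancl)
    next
      assume eq: "equal y z"
      \<comment> \<open>An equality after at least one step is absorbed into the last of these
        steps.\<close>
      from step(3) obtain x where "(step_RmodE \<R>)\<^sup>*\<^sup>* s x" "step_RmodE \<R> x y"
        by (metis tranclpD tranclp.cases tranclp_into_rtranclp rtranclp.rtrancl_refl)
      moreover from this eq have "step_RmodE \<R> x z"
        unfolding step_RmodE_iff using equal_trans by blast
      ultimately show ?case by simp
    qed
  qed
  then have "(step_RmodE \<R>)\<^sup>+\<^sup>+ s s" using assms(3) by blast
  moreover have "wfp ((step_RmodE \<R>)\<inverse>\<inverse>)\<^sup>+\<^sup>+" using wfp_RmodE by (rule wfp_tranclp)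
  ultimately show False unfolding tranclp_converse by (metis conversepI wfp_imp_asymp asympD)
qed

section \<open>Coherence and local confluence\<close>

text \<open>Each term of the chain from \<open>s\<close> to \<open>s'\<close> keeps a one-step
  reduct joinable with \<open>d\<close>. For an equational step from \<open>y\<close> to
  \<open>z\<close>, the reduct \<open>e\<close> of \<open>y\<close> is joinable with
  \<open>z\<close>, and the first step on the side of \<open>z\<close> gives the next
  reduct.\<close>

lemma coherence:
  assumes below: "confluent_below s" and s: "equal s s'" "step_RE \<R> s d"
  shows "\<exists>d'. step_RE \<R> s' d' \<and> RE_joinable \<R> d d'"
  using equal_imp_E_steps[OF s(1)]
proof (induction rule: rtranclp_induct)
  case base
  then show ?case using s(2) RE_joinable_refl step_RE_terms by blast
next
  case (step y z)
  then obtain e where e: "step_RE \<R> y e" "RE_joinable \<R> d e" by blast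
  have "E_step\<^sup>*\<^sup>* s v \<Longrightarrow> equal s v" for v
    by (induction rule: rtranclp_induct)
      (use s step_RE_terms equal_refl equal_trans E_step_equal in blast)+
  then have sy: "equal s y" using step(1) by blast
  have yz: "equal y z" using E_step_equal[OF step(2)] .
  have ez: "RE_joinable \<R> e z" using E_step_peak[OF step(2) e(1)] .
  then obtain u u' where u: "(step_RE \<R>)\<^sup>*\<^sup>* e u" "(step_RE \<R>)\<^sup>*\<^sup>* z u'" "equal u u'"
    using RE_joinable_iff by blast
  have "z \<noteq> u'"
  proof
    assume "z = u'"
    then have "rewrites_mod e z"
      using steps_RE_rewrites_mod[OF u(1)] u(3) by (meson rtranclp.rtrancl_into_rtrancl sup2I2)
    then show False using equal_steps_RE_irrefl[OF equal_sym[OF yz] e(1)] by blast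
  qed
  then obtain e' where e': "step_RE \<R> z e'" "(step_RE \<R>)\<^sup>*\<^sup>* e' u'"
    using u(2) by (meson converse_rtranclpE)
  have "RE_joinable \<R> e e'" using u e'(2) RE_joinable_iff by blast
  \<comment> \<open>As \<open>s\<close> equals \<open>y\<close>, the term \<open>e\<close> is a
    reduct of \<open>s\<close> modulo equality and the hypothesis on \<open>s\<close> applies to
    it.\<close>
  moreover have "confluent_at e" using confluent_below_step[OF below sy e(1)] .
  ultimately have "RE_joinable \<R> d e'"
    using RE_joinable_trans e step_RE_terms by blast
  then show ?case using e'(1) by blast
qed

text \<open>Induction on the position of the step modulo equality. If only the plain step is at the
  root, the peak is critical. Steps in one argument use the induction hypothesis, steps in distinct
  arguments commute.\<close>

lemma local_confluence:
  assumes "step_RE \<R> s d" "step_R \<R> s e" "confluent_below s"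
  shows "RE_joinable \<R> d e"
  using assms unfolding step_RE_iff
proof (induction arbitrary: e rule: act_closure.induct)
  case (root s d)
  then obtain l where l: "equal s l" "rule_inst (Rls_rm \<R>) l d" by (auto simp: mod_inst_def)
  \<comment> \<open>Moving the plain step from \<open>s\<close> to the rule instance
    \<open>l\<close> turns the peak into a critical one.\<close>
  obtain e' where e': "step_RE \<R> l e'" "RE_joinable \<R> e e'"
    using coherence[OF root(3) l(1)] root(2) step_R_imp_step_RE by blast
  have "RE_joinable \<R> e' d" using critical_peak_R[OF l(2) e'(1)] .
  moreover have "confluent_at e'" using confluent_below_step[OF root(3) l(1) e'(1)] .
  ultimately show ?case using e' RE_joinable_trans RE_joinable_sym step_RE_terms by blast
next
  case (arg f ts i t)
  have st: "step_RE \<R> (ts ! i) t" using arg(3) by (simp add: step_RE_iff)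
  note i = repl_less[OF arg(1,2)]
  from arg.prems(1) have "act_closure \<R> (rule_inst (Rls_rm \<R>)) (Fun f ts) e"
    by (simp add: step_R_iff)
  then show ?case
  proof (cases rule: act_closure.cases)
    case root
    then show ?thesis using critical_peak_R step_RE_arg[OF arg(1,2) st] by blast
  next
    case a: (arg j t')
    then have st': "step_R \<R> (ts ! j) t'" by (simp add: step_R_iff)
    then have st'': "step_RE \<R> (ts ! j) t'" by (rule step_R_imp_step_RE)
    show ?thesis
    proof (cases "i = j")
      case True
      then have "RE_joinable \<R> t t'"
        using arg.IH st' confluent_below_arg[OF arg.prems(2) arg(1,2)] by blast
      then show ?thesis using True a(1) RE_joinable_arg[OF _ arg(1,2)] by blast
    next
      case False
      have T: "Fun f (ts[i := t]) \<in> terms \<R>" "Fun f (ts[j := t']) \<in> terms \<R>"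
        using arg(1) update_in_terms step_RE_terms[OF st] step_RE_terms[OF st''] by blast+
      have "step_RE \<R> (Fun f (ts[i := t])) (Fun f (ts[i := t, j := t']))"
        using step_RE_arg[OF T(1) a(3), of t'] st'' False by simp
      moreover have "step_RE \<R> (Fun f (ts[j := t'])) (Fun f (ts[j := t', i := t]))"
        using step_RE_arg[OF T(2) arg(2), of t] st False by simp
      ultimately show ?thesis
        using RE_joinable_refl RE_joinable_steps step_RE_terms False a(1)
        by (metis list_update_swap r_into_rtranclp)
    qed
  qed
qed

text \<open>The second step is made plain by passing to an equal term \<open>t'\<close>. Coherence
  brings the first step to \<open>t'\<close> as well, where \<open>local_confluence\<close>
  applies.\<close>

lemma local_confluence_mod:
  assumes below: "confluent_below w"
    and s: "equal w s" "step_RE \<R> s d" and t: "equal w t" "step_RE \<R> t e"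
  shows "RE_joinable \<R> d e"
proof -
  have below_equal: "confluent_below v" if "equal w v" for v
    using below that unfolding confluent_below_def step_RmodE_iff by (meson equal_trans)
  obtain t' where t': "equal t t'" "step_R \<R> t' e" using step_RE_equal_step_R[OF t(2)] by blast
  have wt': "equal w t'" using t(1) t'(1) equal_trans by blast
  have "equal s t'" using s(1) wt' equal_sym equal_trans by blast
  then obtain d' where d': "step_RE \<R> t' d'" "RE_joinable \<R> d d'"
    using coherence[OF below_equal[OF s(1)] _ s(2)] by blast
  have "RE_joinable \<R> d' e" using local_confluence[OF d'(1) t'(2) below_equal[OF wt']] .
  moreover have "confluent_at d'" using confluent_below_step[OF below wt' d'(1)] .
  ultimately show ?thesis using d' RE_joinable_trans step_RE_terms by blast
qed

section \<open>From local to global confluence\<close>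

lemma rewrites_mod_first:
  assumes "rewrites_mod w a" "w \<in> terms \<R>"
  shows "equal w a \<or> (\<exists>w' d. equal w w' \<and> step_RE \<R> w' d \<and> rewrites_mod d a)"
  using assms
proof (induction rule: converse_rtranclp_induct)
  case base
  then show ?case using equal_refl by blast
next
  case (step y z)
  from step(1) show ?case
  proof
    assume "step_RE \<R> y z"
    then show ?case using step(2,4) equal_refl by blast
  next
    assume "equal y z"
    then show ?case using step(3) ded_bin_terms equal_trans by blast
  qed
qed

text \<open>The argument of Newman's lemma, modulo equality: split off the first rewrite step on
  each side, join locally and use confluence at the reducts.\<close>

lemma confluent_at_if_below:
  assumes below: "confluent_below w"
  shows "confluent_at w"
  unfolding confluent_at_def
proof (intro impI allI)
  fix a b assume w: "w \<in> terms \<R>" and a: "rewrites_mod w a" and b: "rewrites_mod w b"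
  have below_equal: "confluent_below v" if "equal w v" for v
    using below that unfolding confluent_below_def step_RmodE_iff by (meson equal_trans)
  \<comment> \<open>If one side consists of equalities only, coherence supplies it with a step
    matching the first step of the other side.\<close>
  have one: "RE_joinable \<R> a' b'"
    if eq: "equal w a'" and d: "equal w w'" "step_RE \<R> w' d" "rewrites_mod d b'" for a' b' w' d
  proof -
    have "equal w' a'" using eq d(1) equal_sym equal_trans by blast
    then obtain d' where d': "step_RE \<R> a' d'" "RE_joinable \<R> d d'"
      using coherence[OF below_equal[OF d(1)] _ d(2)] by blast
    obtain u where u: "(step_RE \<R>)\<^sup>*\<^sup>* d' u" "rewrites_mod d u"
      using RE_joinable_rewrites_mod[OF RE_joinable_sym[OF d'(2)]] by blast
    have "RE_joinable \<R> u b'"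
      using confluent_below_step[OF below d(1,2)] u(2) d(3) step_RE_terms[OF d(2)]
      by (simp add: confluent_at_def)
    moreover have "(step_RE \<R>)\<^sup>*\<^sup>* a' u" using d'(1) u(1) by (rule converse_rtranclp_into_rtranclp)
    ultimately show ?thesis using RE_joinable_steps by blast
  qed
  from rewrites_mod_first[OF a w] rewrites_mod_first[OF b w] show "RE_joinable \<R> a b"
  proof (elim disjE exE conjE)
    assume "equal w a" "equal w b"
    then show ?thesis using RE_joinable_equal equal_sym equal_trans by blast
  next
    fix w' d assume "equal w a" "equal w w'" "step_RE \<R> w' d" "rewrites_mod d b"
    then show ?thesis by (rule one)
  next
    fix w' d assume "equal w w'" "step_RE \<R> w' d" "rewrites_mod d a" "equal w b"
    then show ?thesis using one RE_joinable_sym by blast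
  next
    fix w1 d1 w2 d2
    assume 1: "equal w w1" "step_RE \<R> w1 d1" "rewrites_mod d1 a"
      and 2: "equal w w2" "step_RE \<R> w2 d2" "rewrites_mod d2 b"
    have T: "d1 \<in> terms \<R>" "d2 \<in> terms \<R>" using 1 2 step_RE_terms by blast+
    have "RE_joinable \<R> d2 d1" using local_confluence_mod[OF below 2(1,2) 1(1,2)] .
    then obtain u where u: "(step_RE \<R>)\<^sup>*\<^sup>* d2 u" "rewrites_mod d1 u"
      using RE_joinable_rewrites_mod by blast
    \<comment> \<open>Two applications of the hypothesis: confluence at \<open>d1\<close> joins
      \<open>a\<close> with the local join \<open>u\<close>, and confluence at \<open>d2\<close>
      joins the result with \<open>b\<close>.\<close>
    have "RE_joinable \<R> a u"
      using confluent_below_step[OF below 1(1,2)] 1(3) u(2) T by (simp add: confluent_at_def)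
    then obtain x where x: "(step_RE \<R>)\<^sup>*\<^sup>* a x" "rewrites_mod u x"
      using RE_joinable_rewrites_mod by blast
    have "rewrites_mod d2 x" using steps_RE_rewrites_mod[OF u(1)] x(2) by (rule rtranclp_trans)
    then have "RE_joinable \<R> x b"
      using confluent_below_step[OF below 2(1,2)] 2(3) T by (simp add: confluent_at_def)
    then show ?thesis using x(1) RE_joinable_steps by blast
  qed
qed

lemma confluent_at: "confluent_at w"
proof -
  have "confluent_below w \<Longrightarrow> act_subterm \<R> w u \<Longrightarrow> confluent_below u" for w u
    by (rotate_tac 1, induction rule: act_subterm.induct) (auto intro: confluent_below_arg)
  note subterm = this
  \<comment> \<open>By the induction hypothesis each reduct of \<open>w\<close> is
    \<open>confluent_below\<close>. By \<open>subterm\<close> so are its active subterms, and all of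
    them are thus confluent.\<close>
  have "confluent_below w"
  proof (induction w rule: wfp_induct_rule[OF wfp_RmodE])
    case (1 w)
    then show ?case
      unfolding confluent_below_def[of w] by (blast intro: confluent_at_if_below subterm)
  qed
  then show ?thesis by (rule confluent_at_if_below)
qed

text \<open>Each link of the chain is joinable: \<open>step_E\<close> lies within equality and a
  plain step is its own join. With \<open>confluent_at\<close> available for every term, the links
  compose.\<close>

theorem church_rosser: "church_rosser_mod_E \<R>"
  unfolding church_rosser_mod_E_def
proof (intro ballI impI)
  fix t t' assume t: "t \<in> terms \<R>"
    and "(sup (step_E \<R>) (sup (step_R \<R>) (step_R \<R>)\<inverse>\<inverse>))\<^sup>*\<^sup>* t t'"
  from this(2) show "RE_joinable \<R> t t'"
  proof (induction rule: rtranclp_induct)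
    case base
    then show ?case using t by (rule RE_joinable_refl)
  next
    case (step y z)
    have R: "RE_joinable \<R> u v \<and> u \<in> terms \<R> \<and> v \<in> terms \<R>" if "step_R \<R> u v" for u v
      using step_R_imp_step_RE[OF that] RE_joinable_refl RE_joinable_steps[of u v v v]
        step_RE_terms by blast
    have "RE_joinable \<R> y z \<and> y \<in> terms \<R>"
      using step(2) R RE_joinable_sym step_E_equal RE_joinable_equal ded_bin_terms by blast
    with step(3) show ?case using RE_joinable_trans confluent_at by blast
  qed
qed

text \<open>\<open>step_RmodE\<close> decomposes into \<open>rewrites_mod\<close>, and each
  \<open>step_RE\<close> in the resulting join is also a \<open>step_RmodE\<close>.\<close>

theorem confluent: "E_confluent \<R>"
  unfolding E_confluent_def
proof (intro ballI allI impI, elim conjE)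
  fix t t1 t2 assume t: "t \<in> terms \<R>"
    and 1: "(step_RmodE \<R>)\<^sup>*\<^sup>* t t1" and 2: "(step_RmodE \<R>)\<^sup>*\<^sup>* t t2"
  have step: "rewrites_mod s s'" if "step_RmodE \<R> s s'" for s s'
  proof -
    obtain u v where "equal s u" "step_RE \<R> u v" "equal v s'"
      using step_RmodE_imp_RE[OF \<open>step_RmodE \<R> s s'\<close>] by blast
    then show ?thesis
      by (meson converse_rtranclp_into_rtranclp r_into_rtranclp sup2I1 sup2I2)
  qed
  have "rewrites_mod s s'" if "(step_RmodE \<R>)\<^sup>*\<^sup>* s s'" for s s'
    using that by (induction rule: rtranclp_induct) (blast intro: rtranclp_trans step)+
  then have "RE_joinable \<R> t1 t2" using 1 2 t confluent_at by (auto simp: confluent_at_def)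
  moreover have "(step_RmodE \<R>)\<^sup>*\<^sup>* s s'" if "(step_RE \<R>)\<^sup>*\<^sup>* s s'" for s s'
    using that
    by (rule rtranclp_mono[THEN predicate2D, rotated])
      (use equal_step_RE_imp_RmodE equal_refl step_RE_terms in blast)
  ultimately show "\<exists>t1' t2'. (step_RmodE \<R>)\<^sup>*\<^sup>* t1 t1' \<and> (step_RmodE \<R>)\<^sup>*\<^sup>* t2 t2' \<and> eq_E \<R> t1' t2'"
    unfolding RE_joinable_def by blast
qed

end

theorem theorem11p3:
  fixes \<R> :: "('p, 'f, 'v :: {countable, infinite}) egtrs"
  assumes "is_egtrs \<R>"
    and "E_terminating \<R>"
    and "\<forall>\<pi> \<in> LCCP_R \<R> \<union> CVP_ps_R \<R> \<union> LCCP_E_R \<R> \<union> CVP_ps_E \<R>. pair_joinable \<R> \<pi>"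
  shows "church_rosser_mod_E \<R> \<and> E_confluent \<R>"
proof -
  \<comment> \<open>The four families are regrouped by the outer rule of the pair: pairs of rewrite
    rules on the one hand, pairs of oriented equations on the other.\<close>
  interpret joinable_egtrs \<R>
    using assms unfolding LCCP_R_def CVP_ps_R_def LCCP_E_R_def CVP_ps_E_def
    by unfold_locales blast+
  show ?thesis using church_rosser confluent by blast
qed

end
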